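(* For each $\boldsymbol{f}\in L^2(\Omega)\times L^2(\Omega)$, let $f_h=\widetilde\nabla_h^\perp\psi^f_h+\nabla_h\phi^f_h$ be its discretization, with components $f_e$. There exist a unique $u_h\in V_h$, and a $p_h\in\Phi_h$, unique up to a constant, such that $$-[\widetilde\nabla_h^\perp\widetilde\nabla_h\times u_h]_e+[\nabla_hp_h]_e=f_e,\qquad 1\le e\le N_e.$$ In addition, the discrete solution $u_h$ is bounded: $$|u_h|_{1,h}\le C|\psi^f|_0+K,$$ where $C$ and $K$ are constants independent of the grid resolution $h$.
   Context: Mesh. $\Omega\subset\mathbb{R}^2$ is an open, bounded, simply connected polygonal domain. A staggered mesh $\mathcal{T}_h$ of $\Omega$ is a pair of meshes (primary and dual) made of polygons (cells) of arbitrary shape. The centers of the primary cells are the vertices of the dual cells and vice versa. Each primary cell edge corresponds to exactly one dual cell edge and vice versa; the two edges of such a pair intersect orthogonally. The segments of $\partial\Omega$ pass through the centers of the primary cells that border the boundary, so those primary cells are only partially contained in $\Omega$; all dual cells lie inside $\Omega$. Primary cells are $A_i$, $1\le i\le N_c+N_{cb}$ ($i\le N_c$: interior cells; the others are on the boundary). Dual cells are $A_\nu$, $1\le\nu\le N_v$. Edge pairs are indexed by $e$, $1\le e\le N_e+N_{eb}$ ($e\le N_e$: interior edge pairs; the others are boundary edge pairs, whose dual edge lies on $\partial\Omega$). $A_i$, $A_\nu$ also denote areas; for a boundary primary cell only the part inside $\Omega$ is meant. $d_e$ is the length of the dual edge (distance between the two primary cell centers); $l_e$ is the length of the primary edge (for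 a boundary $e$: of its part inside $\Omega$). $A_e$ is the diamond-shaped region having the two edges of pair $e$ as diagonals (for a boundary $e$: its part inside $\Omega$), and also its area, so $A_e=\frac12 l_ed_e$. One has Euler's relation $N_c+N_{cb}+N_v=N_e+N_{eb}+1$. Connectivity: $\mathrm{EC}(i)$ = edges bounding primary cell $A_i$; $\mathrm{CE}(e)$ = the primary cells bordering edge $e$; $\mathrm{VE}(e)$ = the dual cells bordering edge $e$ (a single one if $e$ is a boundary edge); $\mathrm{EV}(\nu)$ = edges bounding dual cell $A_\nu$. For each $e$, $\mathbf{n}_e$ is a chosen unit normal to the primary edge and $\mathbf{t}_e=\mathbf{k}\times\mathbf{n}_e$ ($\mathbf{k}$ the upward unit vector). For $i\in\mathrm{CE}(e)$, $n_{e,i}=1$ if $\mathbf{n}_e$ points away from $A_i$ and $-1$ if towards $A_i$. For $\nu\in\mathrm{VE}(e)$, $t_{e,\nu}=1$ if $\mathbf{t}_e$ points away from $A_\nu$ and $-1$ if towards $A_\nu$. Regularity: each $A_e$ is convex (the intersection point of each edge pair lies inside both edges), and the meshes are quasi-uniform: $mh\le l_e,d_e\le Mh$ for all $e$, with $m,M>0$ fixed constants independent of the mesh. A family of such meshes $\mathcal{T}_h$, $h\in\mathcal{H}$, with $h\to0$ is considered. In addition it is assumed that the primary cell edge and the dual cell edge of each pair bisect each other in the interior of the domain. Discrete spaces and operators. $\chi_i,\chi_\nu,\chi_e$ are the characteristic functions of $A_i,A_\nu,A_e$. $\Phi_h=\{\sum_{i=1}^{N_c+N_{cb}}\varphi_i\chi_i:\varphi_i\in\mathbb{R}\}$,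 $\Psi_h=\{\sum_{\nu=1}^{N_v}\psi_\nu\chi_\nu:\psi_\nu\in\mathbb{R}\}$. For $\varphi_h\in\Phi_h$: $\nabla_h\varphi_h=\sum_e[\nabla_h\varphi_h]_e\chi_e\mathbf{n}_e$ with $[\nabla_h\varphi_h]_e=\frac{-1}{d_e}\sum_{i\in\mathrm{CE}(e)}\varphi_in_{e,i}$. For $\psi_h\in\Psi_h$: $\widetilde\nabla_h^\perp\psi_h=\sum_e[\widetilde\nabla_h^\perp\psi_h]_e\chi_e\mathbf{n}_e$ with $[\widetilde\nabla_h^\perp\psi_h]_e=\frac1{l_e}\sum_{\nu\in\mathrm{VE}(e)}\psi_\nu t_{e,\nu}$ (single term on a boundary edge). For $u_h=\sum_eu_e\chi_e\mathbf{n}_e$: $\nabla_h\cdot u_h=\sum_i[\nabla_h\cdot u_h]_i\chi_i$ with $[\nabla_h\cdot u_h]_i=\frac1{A_i}\sum_{e\in\mathrm{EC}(i)}u_el_en_{e,i}$ (for a boundary cell the sum only includes edges inside $\Omega$ and the partial edges meeting the boundary), and $\widetilde\nabla_h\times u_h=\sum_\nu[\widetilde\nabla_h\times u_h]_\nu\chi_\nu\in\Psi_h$ with $[\widetilde\nabla_h\times u_h]_\nu=\frac{-1}{A_\nu}\sum_{e\in\mathrm{EV}(\nu)}u_ed_et_{e,\nu}$. $V_h=\{u_h=\sum_{e=1}^{N_e}u_e\chi_e\mathbf{n}_e\mid\nabla_h\cdot u_h=0\}$ (only interior edges; components on boundary edges are zero), with norm $|u_h|_{1,h}=|\widetilde\nabla_h\times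 u_h|_0$, where $|\cdot|_0$ is the $L^2(\Omega)$ norm. Discretization of the forcing. $\nabla^\perp=\mathbf{k}\times\nabla$. For $\boldsymbol{f}\in L^2(\Omega)\times L^2(\Omega)$ let $\psi^f\in H^1_0(\Omega)$, $\phi^f\in H^1(\Omega)/\mathbb{R}$ be the unique functions with $\boldsymbol{f}=\nabla^\perp\psi^f+\nabla\phi^f$ (Helmholtz decomposition). Set $\psi^f_h=\sum_\nu\psi^f_\nu\chi_\nu$ and $\phi^f_h=\sum_i\phi^f_i\chi_i$, where $\psi^f_\nu$ is the average of $\psi^f$ over $A_\nu$ and $\phi^f_i$ the average of $\phi^f$ over $A_i$. $f_e$ denotes the coefficient of $\chi_e\mathbf{n}_e$ in $f_h$.
   Formalization: Uniqueness of p_h up to a constant is claimed only when the primary cells are connected through interior edge pairs; otherwise it fails, e.g. on a square grid of the unit square, where a corner cell's pressure occurs in no equation with 1 ≤ e ≤ N_e. *)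

theory Defs
  imports "HOL-Analysis.Analysis"
begin

text \<open>Counterclockwise rotation by a right angle, i.e. \<open>w \<mapsto> k \<times> w\<close> for the upward unit vector \<open>k\<close>.\<close>

definition perp :: "real^2 \<Rightarrow> real^2" where
  "perp w = vector [- w $ 2, w $ 1]"


section \<open>Polygons\<close>

abbreviation nxt :: "'a list \<Rightarrow> nat \<Rightarrow> 'a" where
  "nxt vs j \<equiv> vs ! (Suc j mod length vs)"

definition polygon_edges :: "(real^2) list \<Rightarrow> (real^2) set set" where
  "polygon_edges vs = {closed_segment (vs ! j) (nxt vs j) | j. j < length vs}"

text \<open>The closed polygonal line through the vertices does not meet itself. Three consecutive
  vertices may be collinear, and no convexity is required.\<close>

definition simple_polygon :: "(real^2) list \<Rightarrow> bool" where
  "simple_polygon vs \<longleftrightarrow> 3 \<le> length vs \<and> distinct vs \<and>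
     (\<forall>j<length vs. \<forall>k<length vs. j \<noteq> k \<longrightarrow>
        closed_segment (vs ! j) (nxt vs j) \<inter> closed_segment (vs ! k) (nxt vs k)
          \<subseteq> {vs ! j, nxt vs j} \<inter> {vs ! k, nxt vs k})"

definition polygon_interior :: "(real^2) list \<Rightarrow> (real^2) set" where
  "polygon_interior vs = inside (\<Union>(polygon_edges vs))"

definition polygon :: "(real^2) list \<Rightarrow> (real^2) set" where
  "polygon vs = \<Union>(polygon_edges vs) \<union> polygon_interior vs"

text \<open>Vertices listed counterclockwise: the interior lies to the left of every directed edge.\<close>

definition ccw_polygon :: "(real^2) list \<Rightarrow> bool" where
  "ccw_polygon vs \<longleftrightarrow> simple_polygon vs \<and>
     (\<forall>j<length vs. \<forall>x\<in>open_segment (vs ! j) (nxt vs j).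
        \<forall>\<^sub>F s in at_right 0. x + s *\<^sub>R perp (nxt vs j - vs ! j) \<in> polygon_interior vs)"

definition polygonal_domain :: "(real^2) set \<Rightarrow> bool" where
  "polygonal_domain \<Omega> \<longleftrightarrow>
     \<Omega> \<noteq> {} \<and> open \<Omega> \<and> bounded \<Omega> \<and> simply_connected \<Omega> \<and>
     (\<exists>vs. simple_polygon vs \<and> \<Omega> = polygon_interior vs)"


section \<open>Staggered meshes\<close>

text \<open>Cells and edge pairs are indexed from 1. A boundary primary cell and the primary edge of a
  boundary pair are stored in full, including their parts outside the domain; all quantities
  below use the part inside.\<close>

record mesh =
  Nc :: nat
  Ncb :: nat
  Nv :: nat
  Ne :: nat
  Neb :: nat
  pverts :: "nat \<Rightarrow> (real^2) list"
  dverts :: "nat \<Rightarrow> (real^2) list"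
  pcenter :: "nat \<Rightarrow> real^2"
  dcenter :: "nat \<Rightarrow> real^2"
  pedge :: "nat \<Rightarrow> (real^2) set"
  dedge :: "nat \<Rightarrow> (real^2) set"
  nrm :: "nat \<Rightarrow> real^2"

abbreviation PI :: "mesh \<Rightarrow> nat set" where "PI T \<equiv> {1..Nc T + Ncb T}"
abbreviation DI :: "mesh \<Rightarrow> nat set" where "DI T \<equiv> {1..Nv T}"
abbreviation EI :: "mesh \<Rightarrow> nat set" where "EI T \<equiv> {1..Ne T + Neb T}"

definition pcell :: "mesh \<Rightarrow> nat \<Rightarrow> (real^2) set" where
  "pcell T i = polygon (pverts T i)"

definition dcell :: "mesh \<Rightarrow> nat \<Rightarrow> (real^2) set" where
  "dcell T \<nu> = polygon (dverts T \<nu>)"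

definition EC :: "mesh \<Rightarrow> nat \<Rightarrow> nat set" where
  "EC T i = {e \<in> EI T. pedge T e \<in> polygon_edges (pverts T i)}"

definition CE :: "mesh \<Rightarrow> nat \<Rightarrow> nat set" where
  "CE T e = {i \<in> PI T. e \<in> EC T i}"

definition EV :: "mesh \<Rightarrow> nat \<Rightarrow> nat set" where
  "EV T \<nu> = {e \<in> EI T. dedge T e \<in> polygon_edges (dverts T \<nu>)}"

definition VE :: "mesh \<Rightarrow> nat \<Rightarrow> nat set" where
  "VE T e = {\<nu> \<in> DI T. e \<in> EV T \<nu>}"

definition crossing :: "mesh \<Rightarrow> nat \<Rightarrow> real^2" where
  "crossing T e = (THE x. x \<in> pedge T e \<inter> dedge T e)"

definition tng :: "mesh \<Rightarrow> nat \<Rightarrow> real^2" where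
  "tng T e = perp (nrm T e)"

definition points_away :: "real^2 \<Rightarrow> real^2 \<Rightarrow> (real^2) set \<Rightarrow> bool" where
  "points_away x w A \<longleftrightarrow> (\<forall>\<^sub>F s in at_right 0. x + s *\<^sub>R w \<notin> A)"

definition nsgn :: "mesh \<Rightarrow> nat \<Rightarrow> nat \<Rightarrow> real" where
  "nsgn T e i = (if points_away (crossing T e) (nrm T e) (pcell T i) then 1 else -1)"

definition tsgn :: "mesh \<Rightarrow> nat \<Rightarrow> nat \<Rightarrow> real" where
  "tsgn T e \<nu> = (if points_away (crossing T e) (tng T e) (dcell T \<nu>) then 1 else -1)"

definition parea :: "(real^2) set \<Rightarrow> mesh \<Rightarrow> nat \<Rightarrow> real" where
  "parea \<Omega> T i = measure lebesgue (pcell T i \<inter> \<Omega>)"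

definition darea :: "mesh \<Rightarrow> nat \<Rightarrow> real" where
  "darea T \<nu> = measure lebesgue (dcell T \<nu>)"

text \<open>The part of an edge inside the closed domain is a segment, whose length is its diameter.\<close>

definition plen :: "(real^2) set \<Rightarrow> mesh \<Rightarrow> nat \<Rightarrow> real" where
  "plen \<Omega> T e = diameter (pedge T e \<inter> closure \<Omega>)"

definition dlen :: "mesh \<Rightarrow> nat \<Rightarrow> real" where
  "dlen T e = diameter (dedge T e)"

definition staggered_mesh :: "(real^2) set \<Rightarrow> mesh \<Rightarrow> bool" where
  "staggered_mesh \<Omega> T \<longleftrightarrow>
     \<comment> \<open>the cells are polygons forming two meshes of the domain\<close>
     (\<forall>i\<in>PI T. ccw_polygon (pverts T i)) \<and>
     (\<forall>\<nu>\<in>DI T. ccw_polygon (dverts T \<nu>)) \<and>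
     closure \<Omega> \<subseteq> (\<Union>i\<in>PI T. pcell T i) \<and>
     (\<Union>\<nu>\<in>DI T. dcell T \<nu>) = closure \<Omega> \<and>
     (\<forall>i\<in>PI T. \<forall>j\<in>PI T. i \<noteq> j \<longrightarrow> interior (pcell T i) \<inter> interior (pcell T j) \<inter> \<Omega> = {}) \<and>
     (\<forall>\<nu>\<in>DI T. \<forall>\<mu>\<in>DI T. \<nu> \<noteq> \<mu> \<longrightarrow> interior (dcell T \<nu>) \<inter> interior (dcell T \<mu>) = {}) \<and>
     (\<forall>i\<in>{1..Nc T}. pcell T i \<subseteq> \<Omega>) \<and>
     (\<forall>i\<in>{Nc T + 1..Nc T + Ncb T}. pcenter T i \<in> frontier \<Omega>) \<and>
     \<comment> \<open>the centers of either mesh are the vertices of the other one\<close>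
     (\<forall>i\<in>PI T. pcenter T i \<in> interior (pcell T i)) \<and>
     (\<forall>\<nu>\<in>DI T. dcenter T \<nu> \<in> interior (dcell T \<nu>)) \<and>
     (\<Union>\<nu>\<in>DI T. set (dverts T \<nu>)) = pcenter T ` PI T \<and>
     (\<Union>i\<in>PI T. set (pverts T i)) \<inter> closure \<Omega> = dcenter T ` DI T \<and>
     \<comment> \<open>one-to-one correspondence of primary and dual edges\<close>
     bij_betw (pedge T) (EI T)
       {s \<in> (\<Union>i\<in>PI T. polygon_edges (pverts T i)). s \<inter> closure \<Omega> \<noteq> {}} \<and>
     bij_betw (dedge T) (EI T) (\<Union>\<nu>\<in>DI T. polygon_edges (dverts T \<nu>)) \<and>
     (\<forall>e\<in>EI T. \<exists>i j. i \<noteq> j \<and> CE T e = {i, j} \<and>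
        dedge T e = closed_segment (pcenter T i) (pcenter T j)) \<and>
     (\<forall>e\<in>{1..Ne T}. \<exists>\<nu> \<mu>. \<nu> \<noteq> \<mu> \<and> VE T e = {\<nu>, \<mu>} \<and>
        pedge T e = closed_segment (dcenter T \<nu>) (dcenter T \<mu>) \<and>
        pedge T e \<subseteq> \<Omega> \<and> rel_interior (dedge T e) \<subseteq> \<Omega>) \<and>
     (\<forall>e\<in>{Ne T + 1..Ne T + Neb T}. \<exists>\<nu> w. w \<notin> closure \<Omega> \<and> VE T e = {\<nu>} \<and>
        pedge T e = closed_segment (dcenter T \<nu>) w \<and>
        pedge T e \<inter> closure \<Omega> = closed_segment (dcenter T \<nu>) (crossing T e) \<and>
        dedge T e \<subseteq> frontier \<Omega>) \<and>
     \<comment> \<open>an edge crosses only its partner, orthogonally and at a point inside both edges,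
       i.e. the diamond with these two diagonals is convex\<close>
     (\<forall>e\<in>EI T. \<exists>x\<in>rel_interior (pedge T e) \<inter> rel_interior (dedge T e).
        pedge T e \<inter> dedge T e = {x}) \<and>
     (\<forall>e\<in>EI T. \<forall>e'\<in>EI T. e \<noteq> e' \<longrightarrow> pedge T e \<inter> dedge T e' = {}) \<and>
     (\<forall>e\<in>EI T. \<forall>a\<in>pedge T e. \<forall>b\<in>pedge T e. \<forall>c\<in>dedge T e. \<forall>d\<in>dedge T e.
        orthogonal (a - b) (c - d)) \<and>
     (\<forall>e\<in>EI T. norm (nrm T e) = 1 \<and>
        (\<forall>a\<in>pedge T e. \<forall>b\<in>pedge T e. orthogonal (nrm T e) (a - b))) \<and>
     \<comment> \<open>Euler's relation\<close>
     Nc T + Ncb T + Nv T = Ne T + Neb T + 1"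

definition quasi_uniform :: "real \<Rightarrow> real \<Rightarrow> (real^2) set \<Rightarrow> real \<Rightarrow> mesh \<Rightarrow> bool" where
  "quasi_uniform m M \<Omega> h T \<longleftrightarrow> (\<forall>e\<in>EI T.
     m * h \<le> plen \<Omega> T e \<and> plen \<Omega> T e \<le> M * h \<and> m * h \<le> dlen T e \<and> dlen T e \<le> M * h)"

definition bisecting :: "mesh \<Rightarrow> bool" where
  "bisecting T \<longleftrightarrow> (\<forall>e\<in>{1..Ne T}. \<exists>a b c d.
     pedge T e = closed_segment a b \<and> dedge T e = closed_segment c d \<and> midpoint a b = midpoint c d)"

text \<open>The primary cells are connected with each other through interior edge pairs alone. This may
  fail at a corner of the domain: a primary cell there can be bounded by boundary edges only.\<close>

definition interior_connected :: "mesh \<Rightarrow> bool" where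
  "interior_connected T \<longleftrightarrow>
     (\<forall>i\<in>PI T. \<forall>j\<in>PI T. (i, j) \<in> {(i, j). \<exists>e\<in>{1..Ne T}. CE T e = {i, j}}\<^sup>*)"


section \<open>Sobolev spaces and the Helmholtz decomposition\<close>

definition L2 :: "(real^2) set \<Rightarrow> (real^2 \<Rightarrow> 'b::euclidean_space) set" where
  "L2 \<Omega> = {f \<in> borel_measurable (lebesgue_on \<Omega>). integrable (lebesgue_on \<Omega>) (\<lambda>x. (norm (f x))\<^sup>2)}"

definition L2norm :: "(real^2) set \<Rightarrow> (real^2 \<Rightarrow> 'b::euclidean_space) \<Rightarrow> real" where
  "L2norm \<Omega> f = sqrt (LINT x|lebesgue_on \<Omega>. (norm (f x))\<^sup>2)"

definition grad :: "(real^2 \<Rightarrow> real) \<Rightarrow> real^2 \<Rightarrow> real^2" where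
  "grad f x = (\<chi> i. frechet_derivative f (at x) (axis i 1))"

fun C_k :: "nat \<Rightarrow> (real^2 \<Rightarrow> real) \<Rightarrow> bool" where
  "C_k 0 f = continuous_on UNIV f"
| "C_k (Suc k) f = ((\<forall>x. f differentiable (at x)) \<and> (\<forall>i. C_k k (\<lambda>x. grad f x $ i)))"

definition test_functions :: "(real^2) set \<Rightarrow> (real^2 \<Rightarrow> real) set" where
  "test_functions \<Omega> = {\<eta>. (\<forall>k. C_k k \<eta>) \<and>
     compact (closure {x. \<eta> x \<noteq> 0}) \<and> closure {x. \<eta> x \<noteq> 0} \<subseteq> \<Omega>}"

text \<open>\<open>u\<close> lies in \<open>H\<^sup>1(\<Omega>)\<close> and \<open>g\<close> is its weak gradient.\<close>

definition H1_grad :: "(real^2) set \<Rightarrow> (real^2 \<Rightarrow> real) \<Rightarrow> (real^2 \<Rightarrow> real^2) \<Rightarrow> bool" where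
  "H1_grad \<Omega> u g \<longleftrightarrow> u \<in> L2 \<Omega> \<and> g \<in> L2 \<Omega> \<and>
     (\<forall>\<eta>\<in>test_functions \<Omega>. \<forall>i.
        (LINT x|lebesgue_on \<Omega>. u x * grad \<eta> x $ i) = - (LINT x|lebesgue_on \<Omega>. g x $ i * \<eta> x))"

text \<open>\<open>H\<^sup>1\<^sub>0(\<Omega>)\<close> is the closure of the test functions in \<open>H\<^sup>1(\<Omega>)\<close>.\<close>

definition H10_grad :: "(real^2) set \<Rightarrow> (real^2 \<Rightarrow> real) \<Rightarrow> (real^2 \<Rightarrow> real^2) \<Rightarrow> bool" where
  "H10_grad \<Omega> u g \<longleftrightarrow> H1_grad \<Omega> u g \<and>
     (\<forall>\<epsilon>>0. \<exists>\<eta>\<in>test_functions \<Omega>.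
        L2norm \<Omega> (\<lambda>x. u x - \<eta> x) < \<epsilon> \<and> L2norm \<Omega> (\<lambda>x. g x - grad \<eta> x) < \<epsilon>)"

text \<open>\<open>\<phi>\<close> is an arbitrary representative of its class modulo constants.\<close>

definition helmholtz ::
  "(real^2) set \<Rightarrow> (real^2 \<Rightarrow> real^2) \<Rightarrow> (real^2 \<Rightarrow> real) \<Rightarrow> (real^2 \<Rightarrow> real) \<Rightarrow> bool" where
  "helmholtz \<Omega> f \<psi> \<phi> \<longleftrightarrow> (\<exists>g\<psi> g\<phi>. H10_grad \<Omega> \<psi> g\<psi> \<and> H1_grad \<Omega> \<phi> g\<phi> \<and>
     (AE x in lebesgue_on \<Omega>. f x = perp (g\<psi> x) + g\<phi> x))"


section \<open>Discrete operators\<close>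

text \<open>A piecewise constant function \<open>\<Sum>i. \<phi>\<^sub>i \<chi>\<^sub>i\<close>, \<open>\<Sum>\<nu>. \<psi>\<^sub>\<nu> \<chi>\<^sub>\<nu>\<close> or vector field \<open>\<Sum>e. u\<^sub>e \<chi>\<^sub>e n\<^sub>e\<close> is
  represented by its family of coefficients.\<close>

definition grad_h :: "mesh \<Rightarrow> (nat \<Rightarrow> real) \<Rightarrow> nat \<Rightarrow> real" where
  "grad_h T \<phi> e = (- 1 / dlen T e) * (\<Sum>i\<in>CE T e. \<phi> i * nsgn T e i)"

definition perp_grad_h :: "(real^2) set \<Rightarrow> mesh \<Rightarrow> (nat \<Rightarrow> real) \<Rightarrow> nat \<Rightarrow> real" where
  "perp_grad_h \<Omega> T \<psi> e = (1 / plen \<Omega> T e) * (\<Sum>\<nu>\<in>VE T e. \<psi> \<nu> * tsgn T e \<nu>)"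

definition div_h :: "(real^2) set \<Rightarrow> mesh \<Rightarrow> (nat \<Rightarrow> real) \<Rightarrow> nat \<Rightarrow> real" where
  "div_h \<Omega> T u i = (1 / parea \<Omega> T i) * (\<Sum>e\<in>EC T i. u e * plen \<Omega> T e * nsgn T e i)"

definition curl_h :: "mesh \<Rightarrow> (nat \<Rightarrow> real) \<Rightarrow> nat \<Rightarrow> real" where
  "curl_h T u \<nu> = (- 1 / darea T \<nu>) * (\<Sum>e\<in>EV T \<nu>. u e * dlen T e * tsgn T e \<nu>)"

definition V_h :: "(real^2) set \<Rightarrow> mesh \<Rightarrow> (nat \<Rightarrow> real) set" where
  "V_h \<Omega> T = {u. (\<forall>e. e \<notin> {1..Ne T} \<longrightarrow> u e = 0) \<and> (\<forall>i\<in>PI T. div_h \<Omega> T u i = 0)}"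

definition dual_fun :: "mesh \<Rightarrow> (nat \<Rightarrow> real) \<Rightarrow> real^2 \<Rightarrow> real" where
  "dual_fun T \<psi> x = (\<Sum>\<nu>\<in>DI T. \<psi> \<nu> * indicat_real (dcell T \<nu>) x)"

definition norm_1h :: "(real^2) set \<Rightarrow> mesh \<Rightarrow> (nat \<Rightarrow> real) \<Rightarrow> real" where
  "norm_1h \<Omega> T u = L2norm \<Omega> (dual_fun T (curl_h T u))"

definition pavg :: "(real^2) set \<Rightarrow> mesh \<Rightarrow> (real^2 \<Rightarrow> real) \<Rightarrow> nat \<Rightarrow> real" where
  "pavg \<Omega> T \<phi> i = (LINT x|lebesgue_on (pcell T i \<inter> \<Omega>). \<phi> x) / parea \<Omega> T i"

text \<open>Dual cells are contained in the closed domain, so the intersection with \<open>\<Omega>\<close> only removes a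
  null set, on which functions on \<open>\<Omega>\<close> have no meaning.\<close>

definition davg :: "(real^2) set \<Rightarrow> mesh \<Rightarrow> (real^2 \<Rightarrow> real) \<Rightarrow> nat \<Rightarrow> real" where
  "davg \<Omega> T \<psi> \<nu> = (LINT x|lebesgue_on (dcell T \<nu> \<inter> \<Omega>). \<psi> x) / darea T \<nu>"

definition forcing_h ::
  "(real^2) set \<Rightarrow> mesh \<Rightarrow> (real^2 \<Rightarrow> real) \<Rightarrow> (real^2 \<Rightarrow> real) \<Rightarrow> nat \<Rightarrow> real" where
  "forcing_h \<Omega> T \<psi> \<phi> e = perp_grad_h \<Omega> T (davg \<Omega> T \<psi>) e + grad_h T (pavg \<Omega> T \<phi>) e"

definition stokes_h ::
  "(real^2) set \<Rightarrow> mesh \<Rightarrow> (nat \<Rightarrow> real) \<Rightarrow> (nat \<Rightarrow> real) \<Rightarrow> (nat \<Rightarrow> real) \<Rightarrow> bool" where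
  "stokes_h \<Omega> T F u p \<longleftrightarrow>
     (\<forall>e\<in>{1..Ne T}. - perp_grad_h \<Omega> T (curl_h T u) e + grad_h T p e = F e)"

end

theory Submission
  imports Defs
begin

text \<open>With respect to the weights \<open>l\<^sub>e d\<^sub>e\<close>, the discrete gradient is adjoint to minus the divergence
  and the skew gradient to minus the curl. Testing the scheme with \<open>u\<^sub>h\<close> removes both gradients and
  leaves \<open>|u\<^sub>h|\<^sup>2 = - (\<psi>\<^sup>f\<^sub>h, curl u\<^sub>h)\<close>, which is the bound with \<open>C = 1\<close> and \<open>K = 0\<close> since averaging
  is an \<open>L\<^sup>2\<close> contraction. Existence is an orthogonal projection of \<open>- \<psi>\<^sup>f\<^sub>h\<close> onto the curls of \<open>V\<^sub>h\<close>.

  For uniqueness one has to show that a curl-free field on all edges is a gradient. The curl of a gradient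
  vanishes because it telescopes around a dual cell; a gradient or a skew gradient that vanishes on
  all edges forces constant, respectively zero, coefficients, because the domain stays connected
  after removal of the finitely many vertices. Euler's relation says that
  \<open>(\<phi>, \<psi>) \<mapsto> grad \<phi> + skew grad \<psi>\<close>, with \<open>\<phi>\<close> normalised on one cell, is a square linear map, so
  it is bijective, and a curl-free field has no skew part.

  The orientation signs are computed from the Jordan curve theorem: near an interior
  point of an edge, exactly one side of the edge belongs to the polygon.\<close>

section \<open>Finite linear systems\<close>

text \<open>The scheme is imposed on interior edges only, while the relation between gradient and
  curl, and Euler's count, live on all edges. \<open>V_h\<close> mediates: its fields vanish on
  boundary edges, so tested against them sums over all edges and over interior edges coincide. This
  is why curl-free means zero in \<open>V_h\<close>: such a field is a gradient on all edges, yet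
  orthogonal to every gradient. For existence, the residual of the projection onto curls of
  \<open>V_h\<close> is only known to be orthogonal to those curls. A second projection, of edge
  fields onto gradients over the interior edges, has its residuals in \<open>V_h\<close> and thereby
  turns this orthogonality into a pressure. The mesh is given by point sets in the plane, with cells
  that need not be convex, so the signs and the linking of cells through shared edges have to be
  extracted from the topology of polygons.\<close>

lemma weighted_projection:
  fixes a :: "'i \<Rightarrow> 'j \<Rightarrow> real"
  assumes "finite I" "finite J" and w: "\<And>j. j \<in> J \<Longrightarrow> w j > 0"
  shows "\<exists>x. \<forall>i\<in>I. (\<Sum>j\<in>J. w j * a i j * (b j - (\<Sum>k\<in>I. x k * a k j))) = 0"
  using \<open>finite I\<close>
\<comment> \<open>Normal equations of the \<open>w\<close>-weighted projection of \<open>b\<close>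
  onto the span of the vectors \<open>a i\<close>, solved one vector at a time as in Gram-Schmidt;
  dependent vectors are allowed. \<open>b\<close> stays arbitrary because the hypothesis is also
  applied to the new vector \<open>a i\<close>.\<close>
proof (induction I arbitrary: b rule: finite_induct)
  case empty
  then show ?case by simp
next
  case (insert i I)
  define ip where "ip f g = (\<Sum>j\<in>J. w j * f j * g j)" for f g :: "'j \<Rightarrow> real"
  obtain x where x: "\<forall>l\<in>I. ip (a l) (\<lambda>j. b j - (\<Sum>k\<in>I. x k * a k j)) = 0"
    using insert.IH[of b] unfolding ip_def by blast
  obtain c where c: "\<forall>l\<in>I. ip (a l) (\<lambda>j. a i j - (\<Sum>k\<in>I. c k * a k j)) = 0"
    using insert.IH[of "a i"] unfolding ip_def by blast
  define r where "r j = b j - (\<Sum>k\<in>I. x k * a k j)" for j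
  define s where "s j = a i j - (\<Sum>k\<in>I. c k * a k j)" for j
  \<comment> \<open>Coefficient of the residual \<open>r\<close> along \<open>s\<close>, the part of
    \<open>a i\<close> orthogonal to the old vectors. If \<open>ip s s = 0\<close>, then
    \<open>s\<close> vanishes on \<open>J\<close> and the default \<open>t = 0\<close> of division
    by zero is harmless.\<close>
  define t where "t = ip s r / ip s s"
  define y where "y k = (if k = i then t else x k - t * c k)" for k
  have ip_diff: "ip f (\<lambda>j. g j - z * h j) = ip f g - z * ip f h" for f g h z
    unfolding ip_def by (simp add: algebra_simps sum_subtractf sum_distrib_left)
  have res: "b j - (\<Sum>k\<in>insert i I. y k * a k j) = r j - t * s j" for j
  proof -
    have "(\<Sum>k\<in>insert i I. y k * a k j) = t * a i j + (\<Sum>k\<in>I. (x k - t * c k) * a k j)"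
      using insert.hyps by (auto simp: y_def intro!: sum.cong)
    also have "\<dots> = t * a i j + (\<Sum>k\<in>I. x k * a k j) - t * (\<Sum>k\<in>I. c k * a k j)"
      by (simp add: algebra_simps sum_subtractf sum_distrib_left)
    finally show ?thesis by (simp add: r_def s_def algebra_simps)
  qed
  have ort: "ip (a l) (\<lambda>j. r j - t * s j) = 0" if "l \<in> I" for l
    using x c that by (simp add: ip_diff r_def[symmetric] s_def[symmetric])
  have "ip s (\<lambda>j. r j - t * s j) = 0"
  proof (cases "ip s s = 0")
    case True
    have "w j * s j * s j = 0" if "j \<in> J" for j
    proof -
      have "\<forall>j\<in>J. 0 \<le> w j * s j * s j"
        using w by (simp add: less_imp_le mult.assoc)
      with True that \<open>finite J\<close> show ?thesis
        unfolding ip_def by (simp add: sum_nonneg_eq_0_iff)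
    qed
    then have "s j = 0" if "j \<in> J" for j using w[OF that] that by fastforce
    then show ?thesis unfolding ip_def by simp
  next
    case False
    then show ?thesis unfolding ip_diff[of s r t s] by (simp add: t_def)
  qed
  moreover have "ip (a i) g = ip s g + (\<Sum>k\<in>I. c k * ip (a k) g)" for g
  proof -
    have "(\<Sum>k\<in>I. c k * ip (a k) g) = (\<Sum>j\<in>J. \<Sum>k\<in>I. c k * (w j * a k j * g j))"
      unfolding ip_def sum_distrib_left by (rule sum.swap)
    also have "\<dots> = ip (\<lambda>j. \<Sum>k\<in>I. c k * a k j) g"
      unfolding ip_def by (intro sum.cong) (auto simp: sum_distrib_left sum_distrib_right algebra_simps)
    finally show ?thesis
      unfolding ip_def s_def by (simp add: algebra_simps sum_subtractf)
  qed
  ultimately have "ip (a l) (\<lambda>j. r j - t * s j) = 0" if "l \<in> insert i I" for l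
    using that ort by auto
  then show ?case unfolding ip_def res[symmetric] by blast
qed

text \<open>Elimination: an equation with a nonzero coefficient \<open>a j i0\<close> removes the
  unknown \<open>i0\<close>, which lowers both counts by one.\<close>

lemma underdetermined_system:
  fixes a :: "'j \<Rightarrow> 'i \<Rightarrow> real"
  assumes "finite J" "finite I" "card J < card I"
  shows "\<exists>x. (\<exists>i\<in>I. x i \<noteq> 0) \<and> (\<forall>j\<in>J. (\<Sum>i\<in>I. a j i * x i) = 0)"
  using assms
proof (induction J arbitrary: I a rule: finite_induct)
  case empty
  then obtain i where "i \<in> I" by (metis card_gt_0_iff card.empty ex_in_conv)
  then show ?case by (intro exI[of _ "\<lambda>_. 1"]) auto
next
  case (insert j J)
  show ?case
  proof (cases "\<forall>i\<in>I. a j i = 0")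
    case True
    obtain x where "\<exists>i\<in>I. x i \<noteq> 0" "\<forall>j\<in>J. (\<Sum>i\<in>I. a j i * x i) = 0"
      using insert by (metis Suc_lessD card_insert_disjoint)
    with True show ?thesis by (intro exI[of _ x]) auto
  next
    case False
    then obtain i0 where i0: "i0 \<in> I" "a j i0 \<noteq> 0" by blast
    define I' where "I' = I - {i0}"
    have I': "finite I'" "i0 \<notin> I'" "I = insert i0 I'" "card J < card I'"
      using insert i0 by (auto simp: I'_def)
    obtain x where x: "\<exists>i\<in>I'. x i \<noteq> 0"
        "\<forall>k\<in>J. (\<Sum>i\<in>I'. (a k i - a k i0 * a j i / a j i0) * x i) = 0"
      using insert.IH[OF I'(1,4), of "\<lambda>k i. a k i - a k i0 * a j i / a j i0"] by blast
    \<comment> \<open>The eliminated unknown receives the value that makes equation \<open>j\<close>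
      hold; the other equations then become the reduced ones.\<close>
    define y where "y i = (if i = i0 then - (\<Sum>i\<in>I'. a j i * x i) / a j i0 else x i)" for i
    have y: "(\<Sum>i\<in>I. a k i * y i)
        = (\<Sum>i\<in>I'. a k i * x i) - a k i0 * (\<Sum>i\<in>I'. a j i * x i) / a j i0" for k
    proof -
      have "(\<Sum>i\<in>I'. a k i * y i) = (\<Sum>i\<in>I'. a k i * x i)"
        using I'(2) by (intro sum.cong) (auto simp: y_def)
      then show ?thesis using I'(1,2) unfolding I'(3) by (simp add: y_def)
    qed
    have "(\<Sum>i\<in>I. a k i * y i) = 0" if "k \<in> J" for k
    proof -
      have "(\<Sum>i\<in>I'. (a k i - a k i0 * a j i / a j i0) * x i)
          = (\<Sum>i\<in>I'. a k i * x i) - a k i0 * (\<Sum>i\<in>I'. a j i * x i) / a j i0"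
        by (simp add: algebra_simps sum_subtractf sum_distrib_left sum_divide_distrib)
      with x(2) that show ?thesis by (simp add: y)
    qed
    moreover have "(\<Sum>i\<in>I. a j i * y i) = 0" using i0 by (simp add: y)
    moreover have "\<exists>i\<in>I. y i \<noteq> 0" using x(1) I' by (auto simp: y_def)
    ultimately show ?thesis by blast
  qed
qed

text \<open>If the least squares residual \<open>r\<close> had an entry
  \<open>r j \<noteq> 0\<close>, the other equations would be fewer than the unknowns and have a
  nontrivial homogeneous solution \<open>y\<close>. As \<open>r\<close> is orthogonal to all
  columns, \<open>y\<close> would solve equation \<open>j\<close> as well, against
  injectivity.\<close>

lemma square_system_solvable:
  fixes a :: "'j \<Rightarrow> 'i \<Rightarrow> real"
  assumes "finite J" "finite I" "card J \<le> card I"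
    and inj: "\<And>x i. \<forall>j\<in>J. (\<Sum>i\<in>I. a j i * x i) = 0 \<Longrightarrow> i \<in> I \<Longrightarrow> x i = 0"
  shows "\<exists>x. \<forall>j\<in>J. (\<Sum>i\<in>I. a j i * x i) = b j"
proof -
  obtain x where x: "\<forall>i\<in>I. (\<Sum>j\<in>J. 1 * a j i * (b j - (\<Sum>k\<in>I. x k * a j k))) = 0"
    using weighted_projection[OF assms(2,1), of "\<lambda>_. 1" "\<lambda>i j. a j i" b] by auto
  define r where "r j = b j - (\<Sum>k\<in>I. x k * a j k)" for j
  have r: "(\<Sum>j\<in>J. a j i * r j) = 0" if "i \<in> I" for i
    using x that by (simp add: r_def)
  have "r j = 0" if j: "j \<in> J" for j
  proof (rule ccontr)
    assume rj: "r j \<noteq> 0"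
    have "card (J - {j}) < card I"
      using assms j by (metis card_Diff1_less le_neq_implies_less less_le_trans)
    then obtain y where y: "\<exists>i\<in>I. y i \<noteq> 0" "\<forall>k\<in>J - {j}. (\<Sum>i\<in>I. a k i * y i) = 0"
      using underdetermined_system[of "J - {j}" I a] assms by auto
    have "0 = (\<Sum>i\<in>I. y i * (\<Sum>k\<in>J. a k i * r k))" using r by simp
    also have "\<dots> = (\<Sum>k\<in>J. r k * (\<Sum>i\<in>I. a k i * y i))"
      unfolding sum_distrib_left by (subst sum.swap) (simp add: mult_ac)
    also have "\<dots> = r j * (\<Sum>i\<in>I. a j i * y i)"
      using y(2) by (subst sum.remove[OF \<open>finite J\<close> j]) simp
    finally have "\<forall>k\<in>J. (\<Sum>i\<in>I. a k i * y i) = 0" using y(2) rj by auto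
    with inj y(1) show False by blast
  qed
  then show ?thesis by (intro exI[of _ x]) (auto simp: r_def mult.commute)
qed

section \<open>Simple polygons\<close>

lemma inside_linear_image_mem:
  fixes f :: "'a::euclidean_space \<Rightarrow> 'b::euclidean_space"
  assumes f: "linear f" and g: "linear g" "\<And>x. g (f x) = x" "\<And>y. f (g y) = y"
    and x: "x \<in> inside S"
  shows "f x \<in> inside (f ` S)"
proof -
  let ?C = "connected_component_set (- f ` S) (f x)"
  have "x \<notin> S" using x by (simp add: inside_def)
  then have fx: "f x \<notin> f ` S" by (metis g(2) imageE)
  \<comment> \<open>The component of \<open>f x\<close> is pulled back by \<open>g\<close> into the
    component of \<open>x\<close>, which is bounded because \<open>x\<close> is inside
    \<open>S\<close>.\<close>
  have "connected (g ` ?C)"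
    using g(1) by (intro connected_continuous_image linear_continuous_on) (auto simp: linear_linear)
  moreover have "f x \<in> ?C" using fx by simp
  then have "x \<in> g ` ?C" by (metis g(2) image_eqI)
  moreover have "g y \<in> - S" if "y \<in> ?C" for y
  proof -
    have "y \<notin> f ` S" using connected_component_subset[of "- f ` S" "f x"] that by blast
    then show ?thesis by (metis ComplI g(3) image_eqI)
  qed
  then have "g ` ?C \<subseteq> - S" by blast
  ultimately have "g ` ?C \<subseteq> connected_component_set (- S) x"
    by (intro connected_component_maximal)
  moreover have "bounded (connected_component_set (- S) x)"
    using x by (simp add: inside_def)
  ultimately have "bounded (g ` ?C)" by (rule bounded_subset[rotated])
  then have "bounded (f ` g ` ?C)" using f by (metis bounded_linear_image linear_linear)
  moreover have "f ` g ` ?C = ?C" by (simp add: image_image g(3))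
  ultimately show ?thesis using fx by (simp add: inside_def)
qed

lemma inside_linear_image:
  fixes f :: "'a::euclidean_space \<Rightarrow> 'b::euclidean_space"
  assumes "linear f" "linear g" "\<And>x. g (f x) = x" "\<And>y. f (g y) = y"
  shows "inside (f ` S) = f ` inside S"
proof
  show "inside (f ` S) \<subseteq> f ` inside S"
  proof
    fix y assume "y \<in> inside (f ` S)"
    then have "g y \<in> inside (g ` f ` S)" using assms by (intro inside_linear_image_mem[of g f])
    moreover have "g ` f ` S = S" using assms(3) by (simp add: image_image)
    ultimately show "y \<in> f ` inside S" using assms(4) by (intro image_eqI[of _ _ "g y"]) auto
  qed
  show "f ` inside S \<subseteq> inside (f ` S)"
    using inside_linear_image_mem[OF assms] by blast
qed

text \<open>\<open>Jordan_inside_outside\<close> speaks of loops in \<open>complex\<close>; inside,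
  outside and frontier all commute with the linear bijection \<open>f\<close> to
  \<open>real^2\<close>.\<close>

lemma Jordan_real_2:
  fixes c :: "real \<Rightarrow> real^2"
  assumes c: "simple_path c" "pathfinish c = pathstart c"
  shows "inside (path_image c) \<noteq> {} \<and> connected (inside (path_image c)) \<and>
    frontier (inside (path_image c)) = path_image c \<and>
    frontier (outside (path_image c)) = path_image c"
proof -
  define f :: "complex \<Rightarrow> real^2" where "f z = vector [Re z, Im z]" for z
  define g :: "real^2 \<Rightarrow> complex" where "g v = Complex (v $ 1) (v $ 2)" for v
  have fg: "f (g v) = v" "g (f z) = z" for v z
    by (simp_all add: f_def g_def vec_eq_iff forall_2)
  have lf: "linear f" by (rule linearI) (simp_all add: f_def vec_eq_iff forall_2)
  have lg: "linear g" by (rule linearI) (simp_all add: g_def complex_eq_iff)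
  have bij: "bij f" using fg by (intro o_bij[of g]) (auto simp: fun_eq_iff)
  have "inj g" by (metis fg(1) injI)
  have "simple_path (g \<circ> c)" "pathfinish (g \<circ> c) = pathstart (g \<circ> c)"
    using c simple_path_linear_image_eq[OF lg \<open>inj g\<close>] by (auto simp: pathfinish_def pathstart_def)
  from Jordan_inside_outside[OF this]
  have J: "inside (path_image (g \<circ> c)) \<noteq> {}" "connected (inside (path_image (g \<circ> c)))"
    "frontier (inside (path_image (g \<circ> c))) = path_image (g \<circ> c)"
    "frontier (outside (path_image (g \<circ> c))) = path_image (g \<circ> c)" by auto
  have p: "path_image c = f ` path_image (g \<circ> c)"
    by (auto simp: path_image_def image_image fg)
  have inside: "inside (f ` S) = f ` inside S" for S
    using inside_linear_image[OF lf lg fg(2,1)] .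
  then have outside: "outside (f ` S) = f ` outside S" for S
    unfolding outside_inside by (subst bij_image_Compl_eq[OF bij]) (simp add: image_Un)
  have fr: "frontier (f ` S) = f ` frontier S" for S
    using lf bij by (simp add: frontier_def closure_injective_linear_image interior_bijective_linear_image
        bij_is_inj image_set_diff)
  show ?thesis
    unfolding p outside inside fr using J lf by (auto intro: connected_linear_image)
qed

text \<open>The recursion stops at two vertices, so that no constant segment is appended at the end;
  such a segment would spoil \<open>arc\<close>.\<close>

fun polyline :: "'a::real_normed_vector list \<Rightarrow> real \<Rightarrow> 'a" where
  "polyline (a # b # c # vs) = linepath a b +++ polyline (b # c # vs)"
| "polyline vs = linepath (hd vs) (last vs)"

lemma polyline_props:
  assumes "2 \<le> length vs"
  shows "pathstart (polyline vs) = hd vs" "pathfinish (polyline vs) = last vs"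
    "path_image (polyline vs) = (\<Union>j\<in>{j. Suc j < length vs}. closed_segment (vs ! j) (vs ! Suc j))"
  using assms
proof (induction vs rule: polyline.induct)
  case (1 a b c vs)
  {
    case 1
    show ?case by simp
  next
    case 2
    show ?case using "1.IH" by simp
  next
    case 3
    have *: "{j. Suc j < length (a # b # c # vs)} = insert 0 (Suc ` {j. Suc j < length (b # c # vs)})"
    proof (rule set_eqI)
      fix j show "j \<in> {j. Suc j < length (a # b # c # vs)}
          \<longleftrightarrow> j \<in> insert 0 (Suc ` {j. Suc j < length (b # c # vs)})"
        by (cases j) auto
    qed
    show ?case using "1.IH" unfolding * by (simp add: path_image_join)
  }
next
  case ("2_3" a b)
  have "{j. Suc j < length [a, b]} = {0}" by auto
  then show "path_image (polyline [a, b]) = (\<Union>j\<in>{j. Suc j < length [a, b]}. closed_segment ([a, b] ! j) ([a, b] ! Suc j))"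
    by simp
qed simp_all

lemma arc_polyline:
  fixes vs :: "'a::real_normed_vector list"
  assumes "2 \<le> length vs" "distinct vs"
    and "\<And>j k. Suc j < length vs \<Longrightarrow> Suc k < length vs \<Longrightarrow> j \<noteq> k \<Longrightarrow>
      closed_segment (vs ! j) (vs ! Suc j) \<inter> closed_segment (vs ! k) (vs ! Suc k)
        \<subseteq> {vs ! j, vs ! Suc j} \<inter> {vs ! k, vs ! Suc k}"
  shows "arc (polyline vs)"
  using assms
proof (induction vs rule: polyline.induct)
  case (1 a b c vs)
  let ?ws = "b # c # vs"
  have "arc (polyline ?ws)"
  proof (rule "1.IH")
    show "closed_segment (?ws ! j) (?ws ! Suc j) \<inter> closed_segment (?ws ! k) (?ws ! Suc k)
        \<subseteq> {?ws ! j, ?ws ! Suc j} \<inter> {?ws ! k, ?ws ! Suc k}"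
      if "Suc j < length ?ws" "Suc k < length ?ws" "j \<noteq> k" for j k
      using "1.prems"(3)[of "Suc j" "Suc k"] that by simp
  qed (use "1.prems" in auto)
  \<comment> \<open>A common point of the new segment and a later one is a vertex of both, and
    \<open>a\<close> does not recur among the later vertices.\<close>
  moreover have "x = b" if x: "x \<in> closed_segment a b" "x \<in> path_image (polyline ?ws)" for x
  proof -
    obtain k where k: "Suc k < length ?ws" "x \<in> closed_segment (?ws ! k) (?ws ! Suc k)"
      using x(2) polyline_props(3)[of ?ws] by auto
    then have "x \<in> {a, b}" "x \<in> {?ws ! k, ?ws ! Suc k}"
      using "1.prems"(3)[of 0 "Suc k"] x(1) by auto
    moreover have "?ws ! k \<in> set ?ws" "?ws ! Suc k \<in> set ?ws"
      using k(1) by (metis Suc_lessD nth_mem)+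
    ultimately show ?thesis using "1.prems"(2) by auto
  qed
  ultimately show ?case using "1.prems"(2) polyline_props(1)[of ?ws]
    by (auto intro!: arc_join)
next
  case ("2_3" a b)
  then show ?case by (auto simp: arc_linepath)
qed auto

text \<open>Cut open at the closing edge from the last to the first vertex, the boundary is an arc;
  the closing edge meets it in its two ends only.\<close>

lemma simple_polygon_loop:
  assumes "simple_polygon vs"
  obtains g where "simple_path g" "pathfinish g = pathstart g" "path_image g = \<Union>(polygon_edges vs)"
proof
  have vs: "3 \<le> length vs" "distinct vs" and
    seg: "\<And>j k. j < length vs \<Longrightarrow> k < length vs \<Longrightarrow> j \<noteq> k \<Longrightarrow>
        closed_segment (vs ! j) (nxt vs j) \<inter> closed_segment (vs ! k) (nxt vs k)
          \<subseteq> {vs ! j, nxt vs j} \<inter> {vs ! k, nxt vs k}"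
    using assms unfolding simple_polygon_def by blast+
  define n where "n = length vs - 1"
  have n: "length vs = Suc n" "hd vs = vs ! 0" "last vs = vs ! n"
    using vs hd_conv_nth[of vs] last_conv_nth[of vs] by (auto simp: n_def simp flip: length_greater_0_conv)
  let ?g = "polyline vs +++ linepath (last vs) (hd vs)"
  have nx: "nxt vs j = vs ! Suc j" if "Suc j < length vs" for j using that by simp
  have p: "pathstart (polyline vs) = hd vs" "pathfinish (polyline vs) = last vs"
    "path_image (polyline vs) = (\<Union>j\<in>{j. Suc j < length vs}. closed_segment (vs ! j) (vs ! Suc j))"
    using polyline_props[of vs] vs by auto
  have "arc (polyline vs)"
  proof (rule arc_polyline)
    show "closed_segment (vs ! j) (vs ! Suc j) \<inter> closed_segment (vs ! k) (vs ! Suc k)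
        \<subseteq> {vs ! j, vs ! Suc j} \<inter> {vs ! k, vs ! Suc k}"
      if "Suc j < length vs" "Suc k < length vs" "j \<noteq> k" for j k
      using seg[of j k] nx that by simp
  qed (use vs in auto)
  moreover have "last vs \<noteq> hd vs" using vs n by (simp add: nth_eq_iff_index_eq)
  moreover have "path_image (polyline vs) \<inter> closed_segment (last vs) (hd vs) \<subseteq> {hd vs, last vs}"
  proof -
    have "closed_segment (vs ! j) (vs ! Suc j) \<inter> closed_segment (last vs) (hd vs) \<subseteq> {hd vs, last vs}"
      if "Suc j < length vs" for j
      using seg[of j n] that n nx[OF that] by auto
    then show ?thesis unfolding p(3) by blast
  qed
  ultimately show "simple_path ?g" using p by (intro simple_path_join_loop) auto
  show "pathfinish ?g = pathstart ?g" using p by simp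
  have "polygon_edges vs = insert (closed_segment (last vs) (hd vs))
      ((\<lambda>j. closed_segment (vs ! j) (vs ! Suc j)) ` {j. Suc j < length vs})"
  proof -
    have "polygon_edges vs = (\<lambda>j. closed_segment (vs ! j) (nxt vs j)) ` {..<Suc n}"
      by (auto simp: polygon_edges_def n)
    also have "{..<Suc n} = insert n {j. Suc j < length vs}" by (auto simp: n)
    finally show ?thesis using n nx by (auto simp: image_iff)
  qed
  then show "path_image ?g = \<Union>(polygon_edges vs)"
    using p by (auto simp: path_image_join)
qed

section \<open>Topology and measure of closed polygons\<close>

lemma finite_polygon_edges: "finite (polygon_edges vs)"
proof -
  have "polygon_edges vs = (\<lambda>j. closed_segment (vs ! j) (nxt vs j)) ` {..<length vs}"
    by (auto simp: polygon_edges_def)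
  then show ?thesis by simp
qed

lemma compact_polygon_boundary: "compact (\<Union>(polygon_edges vs))"
  by (intro compact_Union finite_polygon_edges) (auto simp: polygon_edges_def)

lemma closed_polygon_boundary: "closed (\<Union>(polygon_edges vs))"
  by (simp add: compact_imp_closed compact_polygon_boundary)

lemma open_polygon_interior: "open (polygon_interior vs)"
  unfolding polygon_interior_def by (intro open_inside closed_polygon_boundary)

lemma negligible_polygon_boundary: "negligible (\<Union>(polygon_edges vs))"
  by (intro negligible_Union finite_polygon_edges)
    (auto simp: polygon_edges_def negligible_convex_interior interior_closed_segment_ge2)

lemma compact_polygon: "compact (polygon vs)"
proof -
  have "closed (polygon vs)"
    unfolding polygon_def polygon_interior_def union_with_inside
    using open_outside[OF closed_polygon_boundary] by (simp add: closed_def)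
  moreover have "bounded (polygon vs)"
    unfolding polygon_def polygon_interior_def
    by (simp add: bounded_inside compact_imp_bounded compact_polygon_boundary)
  ultimately show ?thesis by (simp add: compact_eq_bounded_closed)
qed

lemma simple_polygon_Jordan:
  assumes "simple_polygon vs"
  shows "polygon_interior vs \<noteq> {}"
    and "frontier (polygon_interior vs) = \<Union>(polygon_edges vs)"
    and "frontier (outside (\<Union>(polygon_edges vs))) = \<Union>(polygon_edges vs)"
proof -
  obtain g where "simple_path g" "pathfinish g = pathstart g" "path_image g = \<Union>(polygon_edges vs)"
    using simple_polygon_loop[OF assms] .
  with Jordan_real_2[of g] show "polygon_interior vs \<noteq> {}"
    "frontier (polygon_interior vs) = \<Union>(polygon_edges vs)"
    "frontier (outside (\<Union>(polygon_edges vs))) = \<Union>(polygon_edges vs)"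
    by (auto simp: polygon_interior_def)
qed

lemma closure_polygon_interior: "simple_polygon vs \<Longrightarrow> closure (polygon_interior vs) = polygon vs"
  using simple_polygon_Jordan(2)[of vs] closure_Un_frontier[of "polygon_interior vs"]
  by (auto simp: polygon_def)

text \<open>The complement of the polygon is the outside of the boundary, whose frontier is the
  whole boundary by Jordan. No boundary point is therefore interior to the polygon.\<close>

lemma interior_polygon:
  assumes "simple_polygon vs"
  shows "interior (polygon vs) = polygon_interior vs"
proof -
  let ?B = "\<Union>(polygon_edges vs)"
  have "closure (outside ?B) = outside ?B \<union> ?B"
    using simple_polygon_Jordan(3)[OF assms] by (simp add: closure_Un_frontier)
  then show ?thesis
    unfolding polygon_def polygon_interior_def union_with_inside interior_complement
    by (simp add: inside_outside Un_commute)
qed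

section \<open>The two sides of an edge\<close>

lemma perp_inner_self [simp]: "perp v \<bullet> v = 0" "v \<bullet> perp v = 0"
  by (simp_all add: perp_def inner_vec_def UNIV_2)

lemma perp_inner_perp [simp]: "perp v \<bullet> perp w = v \<bullet> w"
  by (simp add: perp_def inner_vec_def UNIV_2)

lemma perp_eq_0_iff [simp]: "perp v = 0 \<longleftrightarrow> v = 0"
  by (metis inner_eq_zero_iff perp_inner_perp)

text \<open>A hyperplane has empty interior. This provides points strictly on one side of an edge
  line, arbitrarily close to a point of the edge.\<close>

lemma open_meets_off_line:
  fixes x p :: "'a::euclidean_space"
  assumes "open U" "x \<in> closure U" "p \<noteq> 0" "0 < \<epsilon>"
  obtains y where "y \<in> U" "y \<in> ball x \<epsilon>" "(y - x) \<bullet> p \<noteq> 0"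
proof -
  obtain z where "z \<in> U" "dist z x < \<epsilon>"
    using assms(2,4) by (auto simp: closure_approachable)
  then have "interior (U \<inter> ball x \<epsilon>) \<noteq> {}"
    using assms(1) by (auto simp: interior_open open_Int dist_commute)
  moreover have "interior {y. p \<bullet> y = p \<bullet> x} = {}"
    using assms(3) by (rule interior_hyperplane)
  ultimately have "\<not> U \<inter> ball x \<epsilon> \<subseteq> {y. p \<bullet> y = p \<bullet> x}"
    using interior_mono by blast
  then obtain y where "y \<in> U" "y \<in> ball x \<epsilon>" "p \<bullet> y \<noteq> p \<bullet> x" by blast
  then show ?thesis using that[of y] by (simp add: inner_diff_left inner_diff_right inner_commute)
qed

text \<open>In a small ball around \<open>x\<close> the boundary stays on the line of the edge, so
  each open half ball lies in the inside or in the outside. By Jordan \<open>x\<close> is a limit of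
  both, so each gets one half; the sign of \<open>\<sigma>\<close> records which.\<close>

lemma polygon_half_balls:
  assumes vs: "simple_polygon vs" and s: "closed_segment a b \<in> polygon_edges vs"
    and x: "x \<in> open_segment a b"
  obtains \<epsilon> \<sigma> :: real where "0 < \<epsilon>" "\<sigma> \<noteq> 0"
    "\<And>y. y \<in> ball x \<epsilon> \<Longrightarrow> 0 < \<sigma> * ((y - x) \<bullet> perp (b - a)) \<Longrightarrow> y \<in> polygon_interior vs"
    "\<And>y. y \<in> ball x \<epsilon> \<Longrightarrow> \<sigma> * ((y - x) \<bullet> perp (b - a)) < 0 \<Longrightarrow> y \<notin> polygon vs"
proof -
  let ?B = "\<Union>(polygon_edges vs)"
  let ?seg = "\<lambda>j. closed_segment (vs ! j) (nxt vs j)"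
  define p where "p = perp (b - a)"
  obtain j where j: "j < length vs" "closed_segment a b = ?seg j"
    using s by (auto simp: polygon_edges_def)
  then have ab: "{a, b} = {vs ! j, nxt vs j}" by simp
  have "a \<noteq> b" using x by auto
  then have p0: "p \<noteq> 0" by (simp add: p_def)
  define E where "E = \<Union>(?seg ` ({..<length vs} - {j}))"
  have "closed E" unfolding E_def by (intro closed_Union) auto
  moreover have "x \<notin> E"
  proof
    assume "x \<in> E"
    then obtain k where "k < length vs" "k \<noteq> j" "x \<in> ?seg k" by (auto simp: E_def)
    moreover have "x \<in> ?seg j" using x j(2) open_closed_segment by blast
    ultimately have "x \<in> {a, b}"
      using vs j(1) unfolding simple_polygon_def ab by blast
    then show False using x by (auto simp: open_segment_def)
  qed
  ultimately obtain \<epsilon> where \<epsilon>: "0 < \<epsilon>" "ball x \<epsilon> \<subseteq> - E"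
    by (metis ComplI open_Compl open_contains_ball)
  have near: "(y - x) \<bullet> p = 0" if "y \<in> ball x \<epsilon>" "y \<in> ?B" for y
  proof -
    have "y \<notin> E" using that(1) \<epsilon>(2) by blast
    then have "y \<in> ?seg j" using that(2) by (auto simp: polygon_edges_def E_def)
    then have "y \<in> closed_segment a b" by (simp only: j(2))
    then obtain u where u: "y = (1 - u) *\<^sub>R a + u *\<^sub>R b" by (auto simp: in_segment)
    obtain v where v: "x = (1 - v) *\<^sub>R a + v *\<^sub>R b" using x by (auto simp: in_segment)
    have "y - x = (u - v) *\<^sub>R (b - a)" unfolding u v by (simp add: algebra_simps)
    then show ?thesis by (simp add: p_def)
  qed
  define H where "H \<tau> = ball x \<epsilon> \<inter> {y. 0 < \<tau> * ((y - x) \<bullet> p)}" for \<tau> :: real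
  \<comment> \<open>The half ball is convex and avoids the boundary, whose complement is the
    disjoint union of the open sets \<open>U\<close> and \<open>?V\<close>.\<close>
  have side: "H \<tau> \<subseteq> U" if U: "U = polygon_interior vs \<or> U = outside ?B" and ne: "H \<tau> \<inter> U \<noteq> {}" for \<tau> U
  proof -
    let ?V = "- ?B - U"
    have V: "?V = polygon_interior vs \<or> ?V = outside ?B"
    proof -
      have "- ?B - inside ?B = outside ?B" by (subst outside_inside) auto
      moreover have "- ?B - outside ?B = inside ?B" by (subst inside_outside) auto
      ultimately show ?thesis using U by (auto simp: polygon_interior_def)
    qed
    have "H \<tau> = ball x \<epsilon> \<inter> {y. \<tau> * (x \<bullet> p) < (\<tau> *\<^sub>R p) \<bullet> y}"
      unfolding H_def by (auto simp: inner_diff_left algebra_simps inner_commute)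
    then have "convex (H \<tau>)"
      by (metis convex_Int convex_ball convex_halfspace_gt)
    then have "connected (H \<tau>)" by (rule convex_connected)
    moreover have "open U" "open ?V"
      using U V by (auto simp: open_polygon_interior open_outside closed_polygon_boundary)
    moreover have "H \<tau> \<subseteq> - ?B" using near by (fastforce simp: H_def)
    ultimately show ?thesis using ne connectedD[of "H \<tau>" U ?V] by blast
  qed
  have meets: "\<exists>\<tau>\<in>{-1, 1}. H \<tau> \<subseteq> U" if U: "U = polygon_interior vs \<or> U = outside ?B" for U
  proof -
    have "x \<in> ?B" using x s open_closed_segment by blast
    then have "x \<in> closure U"
      using U simple_polygon_Jordan(2,3)[OF vs] by (auto simp: frontier_def)
    moreover have "open U"
      using U by (auto simp: open_polygon_interior open_outside closed_polygon_boundary)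
    ultimately obtain y where y: "y \<in> U" "y \<in> ball x \<epsilon>" "(y - x) \<bullet> p \<noteq> 0"
      using open_meets_off_line p0 \<epsilon>(1) by metis
    then have "y \<in> H 1 \<or> y \<in> H (-1)" by (auto simp: H_def)
    with y(1) side[OF U] show ?thesis by blast
  qed
  obtain \<sigma> where \<sigma>: "\<sigma> \<in> {-1, 1}" "H \<sigma> \<subseteq> polygon_interior vs" using meets by blast
  obtain \<tau> where \<tau>: "\<tau> \<in> {-1, 1}" "H \<tau> \<subseteq> outside ?B" using meets by blast
  \<comment> \<open>An empty half ball would lie in both regions, so nonemptiness is what excludes
    \<open>\<sigma> = \<tau>\<close>. Of a point off the line and its reflection in
    \<open>x\<close>, one belongs to \<open>H \<sigma>\<close>.\<close>
  have "H \<sigma> \<noteq> {}"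
  proof -
    have "x \<in> closure UNIV" by simp
    then obtain y where y: "y \<in> ball x \<epsilon>" "(y - x) \<bullet> p \<noteq> 0"
      using open_meets_off_line[of UNIV x p \<epsilon>] p0 \<epsilon>(1) by blast
    have "2 *\<^sub>R x - y \<in> ball x \<epsilon>"
      using y(1) by (simp add: dist_norm scaleR_2 norm_minus_commute)
    moreover have "(2 *\<^sub>R x - y - x) \<bullet> p = - ((y - x) \<bullet> p)"
      by (simp add: algebra_simps scaleR_2 inner_diff_left inner_add_left)
    ultimately have "y \<in> H \<sigma> \<or> 2 *\<^sub>R x - y \<in> H \<sigma>" using y \<sigma>(1) by (auto simp: H_def)
    then show ?thesis by blast
  qed
  then have "\<sigma> \<noteq> \<tau>"
    using \<sigma>(2) \<tau>(2) inside_Int_outside[of ?B] unfolding polygon_interior_def by blast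
  then have "\<tau> = - \<sigma>" using \<sigma>(1) \<tau>(1) by auto
  show ?thesis
  proof
    show "y \<in> polygon_interior vs" if "y \<in> ball x \<epsilon>" "0 < \<sigma> * ((y - x) \<bullet> perp (b - a))" for y
      using that \<sigma>(2) by (auto simp: H_def p_def)
    show "y \<notin> polygon vs" if "y \<in> ball x \<epsilon>" "\<sigma> * ((y - x) \<bullet> perp (b - a)) < 0" for y
    proof -
      have "y \<in> outside ?B" using that \<tau>(2) \<open>\<tau> = - \<sigma>\<close> by (auto simp: H_def p_def)
      then show ?thesis by (simp add: polygon_def polygon_interior_def union_with_inside)
    qed
  qed (use \<epsilon> \<sigma>(1) in auto)
qed

lemma eventually_ray_in_ball:
  fixes x w :: "'a::real_normed_vector"
  assumes "0 < \<epsilon>"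
  shows "\<forall>\<^sub>F s in at_right 0. x + s *\<^sub>R w \<in> ball x \<epsilon>"
proof -
  have "((\<lambda>s. x + s *\<^sub>R w) \<longlongrightarrow> x + 0 *\<^sub>R w) (at_right 0)"
    by (intro tendsto_intros)
  then show ?thesis using assms tendstoD by (force simp: dist_commute)
qed

lemma polygon_ray_sides:
  assumes vs: "simple_polygon vs" and s: "closed_segment a b \<in> polygon_edges vs"
    and x: "x \<in> open_segment a b"
  obtains \<sigma> :: real where "\<sigma> \<noteq> 0"
    "\<And>w. 0 < \<sigma> * (w \<bullet> perp (b - a)) \<Longrightarrow> \<forall>\<^sub>F s in at_right 0. x + s *\<^sub>R w \<in> polygon_interior vs"
    "\<And>w. \<sigma> * (w \<bullet> perp (b - a)) < 0 \<Longrightarrow> \<forall>\<^sub>F s in at_right 0. x + s *\<^sub>R w \<notin> polygon vs"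
proof -
  obtain \<epsilon> \<sigma> :: real where \<epsilon>: "0 < \<epsilon>" "\<sigma> \<noteq> 0"
    "\<And>y. y \<in> ball x \<epsilon> \<Longrightarrow> 0 < \<sigma> * ((y - x) \<bullet> perp (b - a)) \<Longrightarrow> y \<in> polygon_interior vs"
    "\<And>y. y \<in> ball x \<epsilon> \<Longrightarrow> \<sigma> * ((y - x) \<bullet> perp (b - a)) < 0 \<Longrightarrow> y \<notin> polygon vs"
    using polygon_half_balls[OF assms] by metis
  have pos: "\<forall>\<^sub>F s in at_right (0::real). 0 < s" by (simp add: eventually_at_right_less)
  show ?thesis
  proof
    show "\<forall>\<^sub>F s in at_right 0. x + s *\<^sub>R w \<in> polygon_interior vs" if "0 < \<sigma> * (w \<bullet> perp (b - a))" for w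
      using eventually_ray_in_ball[OF \<epsilon>(1), of x w] pos
    proof eventually_elim
      case (elim s)
      have "0 < s * (\<sigma> * (w \<bullet> perp (b - a)))" using that elim(2) by simp
      then show ?case using \<epsilon>(3) elim(1) by (simp add: mult_ac)
    qed
    show "\<forall>\<^sub>F s in at_right 0. x + s *\<^sub>R w \<notin> polygon vs" if "\<sigma> * (w \<bullet> perp (b - a)) < 0" for w
      using eventually_ray_in_ball[OF \<epsilon>(1), of x w] pos
    proof eventually_elim
      case (elim s)
      have "s * (\<sigma> * (w \<bullet> perp (b - a))) < 0" using that elim(2) by (simp add: mult_pos_neg)
      then show ?case using \<epsilon>(4) elim(1) by (simp add: mult_ac)
    qed
  qed (rule \<epsilon>(2))
qed

text \<open>The sign from \<open>polygon_ray_sides\<close> is unknown but cancels against a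
  reference direction \<open>v\<close> that enters the polygon: towards the center for primary
  cells, the left normal of the counterclockwise boundary for dual cells.\<close>

lemma points_away_polygon_iff:
  assumes "simple_polygon vs" "closed_segment a b \<in> polygon_edges vs" "x \<in> open_segment a b"
    and w: "w \<bullet> perp (b - a) \<noteq> 0"
    and v: "\<forall>\<^sub>F s in at_right 0. x + s *\<^sub>R v \<in> polygon_interior vs" "v \<bullet> perp (b - a) \<noteq> 0"
  shows "points_away x w (polygon vs) \<longleftrightarrow> (w \<bullet> perp (b - a)) * (v \<bullet> perp (b - a)) < 0"
proof -
  obtain \<sigma> :: real where \<sigma>: "\<sigma> \<noteq> 0"
    "\<And>w. 0 < \<sigma> * (w \<bullet> perp (b - a)) \<Longrightarrow> \<forall>\<^sub>F s in at_right 0. x + s *\<^sub>R w \<in> polygon_interior vs"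
    "\<And>w. \<sigma> * (w \<bullet> perp (b - a)) < 0 \<Longrightarrow> \<forall>\<^sub>F s in at_right 0. x + s *\<^sub>R w \<notin> polygon vs"
    using polygon_ray_sides[OF assms(1-3)] by metis
  have int: "polygon_interior vs \<subseteq> polygon vs" by (simp add: polygon_def)
  \<comment> \<open>\<open>points_away\<close> is an eventual statement, so refuting it takes more
    than one ray point; the filter \<open>at_right 0\<close> being nontrivial settles it.\<close>
  have excl: "\<not> (\<forall>\<^sub>F s in at_right 0. x + s *\<^sub>R w \<notin> polygon vs)"
    if "\<forall>\<^sub>F s in at_right 0. x + s *\<^sub>R w \<in> polygon_interior vs" for w
  proof
    assume "\<forall>\<^sub>F s in at_right 0. x + s *\<^sub>R w \<notin> polygon vs"
    with that have "\<forall>\<^sub>F s in at_right (0::real). False"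
      by eventually_elim (use int in blast)
    then show False by simp
  qed
  have "\<not> \<sigma> * (v \<bullet> perp (b - a)) < 0" using \<sigma>(3) v(1) excl by blast
  then have \<sigma>v: "0 < \<sigma> * (v \<bullet> perp (b - a))" using \<sigma>(1) v(2) by (auto simp: not_less le_less)
  have "points_away x w (polygon vs) \<longleftrightarrow> \<sigma> * (w \<bullet> perp (b - a)) < 0"
    unfolding points_away_def using \<sigma> w excl by (metis linorder_neqE mult_eq_0_iff)
  also have "\<dots> \<longleftrightarrow> (w \<bullet> perp (b - a)) * (v \<bullet> perp (b - a)) < 0"
    using \<sigma>v by (auto simp: zero_less_mult_iff mult_less_0_iff)
  finally show ?thesis .
qed

text \<open>Away from the vertices, a point \<open>x\<close> common to a cell \<open>i\<close> in
  \<open>Z\<close> and a cell \<open>j\<close> outside \<open>Z\<close> cannot lie inside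
  \<open>i\<close>, as the interiors would meet. On an edge of \<open>i\<close>, the cell
  \<open>i\<close> and its partner \<open>k\<close> in \<open>Z\<close> fill both sides and leave no
  room for \<open>j\<close>. So if both colours occurred, two closed sets would separate the
  connected set \<open>\<Omega> - F\<close>.\<close>

lemma polygon_cover_colouring:
  fixes P :: "'i \<Rightarrow> (real^2) list"
  assumes "finite I" "open \<Omega>" "connected \<Omega>"
    and simple: "\<And>i. i \<in> I \<Longrightarrow> simple_polygon (P i)"
    and cover: "\<Omega> \<subseteq> (\<Union>i\<in>I. polygon (P i))"
    and disj: "\<And>i j. i \<in> I \<Longrightarrow> j \<in> I \<Longrightarrow> i \<noteq> j \<Longrightarrow> polygon_interior (P i) \<inter> polygon_interior (P j) \<inter> \<Omega> = {}"
    and ne: "\<And>i. i \<in> I \<Longrightarrow> polygon_interior (P i) \<inter> \<Omega> \<noteq> {}"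
    and share: "\<And>i s. i \<in> I \<Longrightarrow> s \<in> polygon_edges (P i) \<Longrightarrow> s \<inter> \<Omega> \<noteq> {} \<Longrightarrow>
        \<exists>k\<in>I. k \<noteq> i \<and> s \<in> polygon_edges (P k) \<and> (i \<in> Z \<longleftrightarrow> k \<in> Z)"
    and ij: "i \<in> I" "i \<in> Z" "j \<in> I"
  shows "j \<in> Z"
proof (rule ccontr)
  assume "j \<notin> Z"
  \<comment> \<open>Cells that meet at a vertex need not share an edge there. Removing finitely many
    points keeps an open connected subset of the plane connected.\<close>
  define F where "F = (\<Union>i\<in>I. set (P i))"
  have "finite F" using \<open>finite I\<close> by (simp add: F_def)
  have "connected (\<Omega> - F)"
    using \<open>open \<Omega>\<close> \<open>connected \<Omega>\<close> \<open>finite F\<close>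
    by (intro connected_open_diff_countable) (auto simp: countable_finite)
  have separate: False
    if x: "x \<in> \<Omega> - F" and i: "i \<in> I" "i \<in> Z" "x \<in> polygon (P i)"
      and j: "j \<in> I" "j \<notin> Z" "x \<in> polygon (P j)" for x i j
  proof -
    have xj: "x \<in> closure (polygon_interior (P j))"
      using j simple by (simp add: closure_polygon_interior)
    have "i \<noteq> j" using i j by blast
    show False
    proof (cases "x \<in> polygon_interior (P i)")
      case True
      with x have "polygon_interior (P j) \<inter> (polygon_interior (P i) \<inter> \<Omega>) \<noteq> {}"
        using xj \<open>open \<Omega>\<close> open_Int_closure_eq_empty[of "polygon_interior (P i) \<inter> \<Omega>" "polygon_interior (P j)"]
        by (auto simp: open_Int open_polygon_interior)
      then show False using disj[OF i(1) j(1) \<open>i \<noteq> j\<close>] by blast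
    next
      case False
      then obtain l where l: "l < length (P i)" "x \<in> closed_segment (P i ! l) (nxt (P i) l)"
        using i(3) by (auto simp: polygon_def polygon_edges_def)
      define a where "a = P i ! l"
      define b where "b = nxt (P i) l"
      have "length (P i) > 0" using l(1) by linarith
      then have "a \<in> F" "b \<in> F"
        using i(1) l(1) by (auto simp: a_def b_def F_def intro!: bexI[of _ i])
      then have xo: "x \<in> open_segment a b"
        using l(2) x by (auto simp: a_def b_def open_segment_def)
      have s: "closed_segment a b \<in> polygon_edges (P i)"
        using l(1) by (auto simp: a_def b_def polygon_edges_def)
      have "closed_segment a b \<inter> \<Omega> \<noteq> {}" using l(2) x by (auto simp: a_def b_def)
      then obtain k where k: "k \<in> I" "k \<noteq> i" "closed_segment a b \<in> polygon_edges (P k)" "k \<in> Z"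
        using share[OF i(1) s] i(2) by blast
      obtain \<epsilon>1 \<sigma>1 :: real where 1: "0 < \<epsilon>1" "\<sigma>1 \<noteq> 0"
        "\<And>y. y \<in> ball x \<epsilon>1 \<Longrightarrow> 0 < \<sigma>1 * ((y - x) \<bullet> perp (b - a)) \<Longrightarrow> y \<in> polygon_interior (P i)"
        using polygon_half_balls[OF simple[OF i(1)] s xo] by metis
      obtain \<epsilon>2 \<sigma>2 :: real where 2: "0 < \<epsilon>2" "\<sigma>2 \<noteq> 0"
        "\<And>y. y \<in> ball x \<epsilon>2 \<Longrightarrow> 0 < \<sigma>2 * ((y - x) \<bullet> perp (b - a)) \<Longrightarrow> y \<in> polygon_interior (P k)"
        using polygon_half_balls[OF simple[OF k(1)] k(3) xo] by metis
      obtain \<epsilon>3 where 3: "0 < \<epsilon>3" "ball x \<epsilon>3 \<subseteq> \<Omega>"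
        using x \<open>open \<Omega>\<close> open_contains_ball by blast
      define \<epsilon> where "\<epsilon> = min \<epsilon>1 (min \<epsilon>2 \<epsilon>3)"
      have "a \<noteq> b" using xo by auto
      then obtain y where y: "y \<in> polygon_interior (P j)" "y \<in> ball x \<epsilon>" "(y - x) \<bullet> perp (b - a) \<noteq> 0"
        using open_meets_off_line[OF open_polygon_interior xj, of "perp (b - a)" \<epsilon>] 1(1) 2(1) 3(1)
        by (auto simp: \<epsilon>_def)
      \<comment> \<open>The point \<open>y\<close> of \<open>P j\<close> near \<open>x\<close>
        avoids \<open>P i\<close> and \<open>P k\<close>, so it lies on the wrong side for both; its
        reflection \<open>z\<close> is then in both interiors.\<close>
      define z where "z = 2 *\<^sub>R x - y"
      have z: "z \<in> ball x \<epsilon>" "(z - x) \<bullet> perp (b - a) = - ((y - x) \<bullet> perp (b - a))"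
        using y(2) by (simp_all add: z_def dist_norm scaleR_2 norm_minus_commute algebra_simps
            inner_diff_left inner_add_left)
      have "y \<notin> polygon_interior (P i)" "y \<notin> polygon_interior (P k)"
      proof -
        have "y \<in> \<Omega>" using y(2) 3(2) by (auto simp: \<epsilon>_def)
        moreover have "k \<noteq> j" using k(4) j(2) by blast
        ultimately show "y \<notin> polygon_interior (P i)" "y \<notin> polygon_interior (P k)"
          using disj[OF i(1) j(1)] disj[OF k(1) j(1)] y(1) \<open>i \<noteq> j\<close> by blast+
      qed
      then have "\<not> 0 < \<sigma>1 * ((y - x) \<bullet> perp (b - a))" "\<not> 0 < \<sigma>2 * ((y - x) \<bullet> perp (b - a))"
        using 1(3)[of y] 2(3)[of y] y(2) by (auto simp: \<epsilon>_def)
      then have "0 < \<sigma>1 * ((z - x) \<bullet> perp (b - a))" "0 < \<sigma>2 * ((z - x) \<bullet> perp (b - a))"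
        using 1(2) 2(2) y(3) by (auto simp: z(2) not_less le_less)
      then have "z \<in> polygon_interior (P i)" "z \<in> polygon_interior (P k)" "z \<in> \<Omega>"
        using 1(3)[of z] 2(3)[of z] 3(2) z(1) by (auto simp: \<epsilon>_def)
      then show False using disj[OF i(1) k(1)] k(2) by blast
    qed
  qed
  define U where "U = (\<Union>i\<in>I \<inter> Z. polygon (P i))"
  define W where "W = (\<Union>i\<in>I - Z. polygon (P i))"
  have "closed U" "closed W"
    unfolding U_def W_def using \<open>finite I\<close> compact_polygon compact_imp_closed
    by (auto intro!: closed_UN)
  moreover have "\<Omega> - F \<subseteq> U \<union> W" using cover by (auto simp: U_def W_def)
  moreover have "U \<inter> W \<inter> (\<Omega> - F) = {}" using separate by (auto simp: U_def W_def)
  moreover have meet: "polygon (P i) \<inter> (\<Omega> - F) \<noteq> {}" if "i \<in> I" for i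
  proof -
    have "infinite (polygon_interior (P i) \<inter> \<Omega>)"
      using ne[OF that] \<open>open \<Omega>\<close> open_polygon_interior
      by (meson finite_imp_not_open open_Int)
    then have "\<not> polygon_interior (P i) \<inter> \<Omega> \<subseteq> F" using \<open>finite F\<close> finite_subset by blast
    then show ?thesis by (auto simp: polygon_def)
  qed
  have "U \<inter> (\<Omega> - F) \<noteq> {}" using meet[OF ij(1)] ij(1,2) by (auto simp: U_def)
  moreover have "W \<inter> (\<Omega> - F) \<noteq> {}" using meet[OF ij(3)] ij(3) \<open>j \<notin> Z\<close> by (auto simp: W_def)
  ultimately show False using \<open>connected (\<Omega> - F)\<close> unfolding connected_closed by blast
qed

lemma simple_polygon_nxt_neq:
  assumes "simple_polygon vs" "k < length vs"
  shows "vs ! k \<noteq> nxt vs k"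
proof -
  have len: "3 \<le> length vs" "distinct vs" using assms(1) by (auto simp: simple_polygon_def)
  have "Suc k mod length vs \<noteq> k"
    using assms(2) len(1) by (cases "Suc k = length vs") auto
  moreover have "Suc k mod length vs < length vs" using assms(2) by (intro mod_less_divisor) auto
  ultimately show ?thesis
    using assms(2) len(2) by (subst nth_eq_iff_index_eq) auto
qed

lemma polygon_edge_ends:
  assumes "simple_polygon vs" "s \<in> polygon_edges vs"
  obtains k where "k < length vs" "s = closed_segment (vs ! k) (nxt vs k)" "vs ! k \<noteq> nxt vs k"
  using assms simple_polygon_nxt_neq by (auto simp: polygon_edges_def)

lemma perp_of_orthogonal:
  assumes "u \<bullet> d = 0" "d \<noteq> 0"
  obtains \<kappa> where "u = \<kappa> *\<^sub>R perp d"
proof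
  have d: "d$1 * d$1 + d$2 * d$2 \<noteq> 0"
    using assms(2) by (simp add: vec_eq_iff forall_2 sum_squares_eq_zero_iff)
  have ud: "u$1 * d$1 = - (u$2 * d$2)"
    using assms(1) by (simp add: inner_vec_def UNIV_2)
  have "u $ 1 * (d$1 * d$1 + d$2 * d$2) = (u $ 2 * d $ 1 - u $ 1 * d $ 2) * - d $ 2"
    "u $ 2 * (d$1 * d$1 + d$2 * d$2) = (u $ 2 * d $ 1 - u $ 1 * d $ 2) * d $ 1"
    using ud by algebra+
  \<comment> \<open>The coefficient is \<open>u \<bullet> perp d / (d \<bullet> d)\<close>, written
    in coordinates.\<close>
  then show "u = ((u $ 2 * d $ 1 - u $ 1 * d $ 2) / (d$1 * d$1 + d$2 * d$2)) *\<^sub>R perp d"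
    using d by (simp add: vec_eq_iff forall_2 perp_def field_simps)
qed

section \<open>Geometry of a staggered mesh\<close>

text \<open>A single mesh; the two positivity assumptions are what quasi-uniformity supplies for a
  fixed \<open>h > 0\<close>.\<close>

locale staggered_domain =
  fixes \<Omega> :: "(real^2) set" and T :: mesh
  assumes domain: "polygonal_domain \<Omega>"
    and staggered: "staggered_mesh \<Omega> T"
    and plen_pos: "e \<in> EI T \<Longrightarrow> 0 < plen \<Omega> T e"
    and dlen_pos: "e \<in> EI T \<Longrightarrow> 0 < dlen T e"
begin

lemma open_domain: "open \<Omega>"
  and connected_domain: "connected \<Omega>"
  and bounded_domain: "bounded \<Omega>"
  and domain_nonempty: "\<Omega> \<noteq> {}"
  using domain by (auto simp: polygonal_domain_def simply_connected_imp_connected)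

text \<open>A simple polygon has no slits, so its interior is regular open, which confines the
  interiors of dual cells to \<open>\<Omega>\<close>. The infinite frontier later yields a boundary
  point that is not a vertex.\<close>

lemma interior_closure_domain: "interior (closure \<Omega>) = \<Omega>"
  and negligible_frontier_domain: "negligible (frontier \<Omega>)"
  and infinite_frontier_domain: "infinite (frontier \<Omega>)"
proof -
  obtain vs where vs: "simple_polygon vs" "\<Omega> = polygon_interior vs"
    using domain by (auto simp: polygonal_domain_def)
  have fr: "frontier \<Omega> = \<Union>(polygon_edges vs)"
    using simple_polygon_Jordan(2)[OF vs(1)] vs(2) by simp
  show "interior (closure \<Omega>) = \<Omega>"
    using vs by (simp add: closure_polygon_interior interior_polygon)
  show "negligible (frontier \<Omega>)"
    by (simp add: fr negligible_polygon_boundary)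
  have "0 < length vs" "Suc 0 < length vs" "distinct vs"
    using vs(1) by (auto simp: simple_polygon_def)
  then have "vs ! 0 \<noteq> nxt vs 0" "closed_segment (vs ! 0) (nxt vs 0) \<in> polygon_edges vs"
    by (auto simp: polygon_edges_def nth_eq_iff_index_eq)
  moreover from this(2) have "closed_segment (vs ! 0) (nxt vs 0) \<subseteq> frontier \<Omega>"
    unfolding fr by (rule Union_upper)
  ultimately show "infinite (frontier \<Omega>)"
    by (meson finite_closed_segment finite_subset)
qed

lemma pverts_ccw: "\<forall>i\<in>PI T. ccw_polygon (pverts T i)"
  and dverts_ccw: "\<forall>\<nu>\<in>DI T. ccw_polygon (dverts T \<nu>)"
  and pcells_cover: "closure \<Omega> \<subseteq> (\<Union>i\<in>PI T. pcell T i)"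
  and dcells_cover: "(\<Union>\<nu>\<in>DI T. dcell T \<nu>) = closure \<Omega>"
  and pcells_disjoint:
    "\<forall>i\<in>PI T. \<forall>j\<in>PI T. i \<noteq> j \<longrightarrow> interior (pcell T i) \<inter> interior (pcell T j) \<inter> \<Omega> = {}"
  and dcells_disjoint:
    "\<forall>\<nu>\<in>DI T. \<forall>\<mu>\<in>DI T. \<nu> \<noteq> \<mu> \<longrightarrow> interior (dcell T \<nu>) \<inter> interior (dcell T \<mu>) = {}"
  and pcell_inside: "\<forall>i\<in>{1..Nc T}. pcell T i \<subseteq> \<Omega>"
  and pcenter_frontier: "\<forall>i\<in>{Nc T + 1..Nc T + Ncb T}. pcenter T i \<in> frontier \<Omega>"
  and pcenter_interior: "\<forall>i\<in>PI T. pcenter T i \<in> interior (pcell T i)"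
  and pedge_bij: "bij_betw (pedge T) (EI T)
       {s \<in> (\<Union>i\<in>PI T. polygon_edges (pverts T i)). s \<inter> closure \<Omega> \<noteq> {}}"
  and dedge_bij: "bij_betw (dedge T) (EI T) (\<Union>\<nu>\<in>DI T. polygon_edges (dverts T \<nu>))"
  and primal_pair: "\<forall>e\<in>EI T. \<exists>i j. i \<noteq> j \<and> CE T e = {i, j} \<and>
        dedge T e = closed_segment (pcenter T i) (pcenter T j)"
  and interior_pair: "\<forall>e\<in>{1..Ne T}. \<exists>\<nu> \<mu>. \<nu> \<noteq> \<mu> \<and> VE T e = {\<nu>, \<mu>} \<and>
        pedge T e = closed_segment (dcenter T \<nu>) (dcenter T \<mu>) \<and>
        pedge T e \<subseteq> \<Omega> \<and> rel_interior (dedge T e) \<subseteq> \<Omega>"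
  and boundary_pair: "\<forall>e\<in>{Ne T + 1..Ne T + Neb T}. \<exists>\<nu> w. w \<notin> closure \<Omega> \<and> VE T e = {\<nu>} \<and>
        pedge T e = closed_segment (dcenter T \<nu>) w \<and>
        pedge T e \<inter> closure \<Omega> = closed_segment (dcenter T \<nu>) (crossing T e) \<and>
        dedge T e \<subseteq> frontier \<Omega>"
  and edges_cross: "\<forall>e\<in>EI T. \<exists>x\<in>rel_interior (pedge T e) \<inter> rel_interior (dedge T e).
        pedge T e \<inter> dedge T e = {x}"
  and edges_cross_only: "\<forall>e\<in>EI T. \<forall>e'\<in>EI T. e \<noteq> e' \<longrightarrow> pedge T e \<inter> dedge T e' = {}"
  and edges_orthogonal:
    "\<forall>e\<in>EI T. \<forall>a\<in>pedge T e. \<forall>b\<in>pedge T e. \<forall>c\<in>dedge T e. \<forall>d\<in>dedge T e. orthogonal (a - b) (c - d)"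
  and nrm_props: "\<forall>e\<in>EI T. norm (nrm T e) = 1 \<and>
        (\<forall>a\<in>pedge T e. \<forall>b\<in>pedge T e. orthogonal (nrm T e) (a - b))"
  and Euler: "Nc T + Ncb T + Nv T = Ne T + Neb T + 1"
  by (insert staggered[unfolded staggered_mesh_def]) (elim conjE, assumption)+

lemma simple_pverts: "i \<in> PI T \<Longrightarrow> simple_polygon (pverts T i)"
  using pverts_ccw by (auto simp: ccw_polygon_def)

lemma simple_dverts: "\<nu> \<in> DI T \<Longrightarrow> simple_polygon (dverts T \<nu>)"
  using dverts_ccw by (auto simp: ccw_polygon_def)

lemma CE_subset: "CE T e \<subseteq> PI T"
  by (auto simp: CE_def)

lemma VE_subset: "VE T e \<subseteq> DI T"
  by (auto simp: VE_def)

lemma EI_split: "e \<in> EI T \<Longrightarrow> e \<in> {1..Ne T} \<or> e \<in> {Ne T + 1..Ne T + Neb T}"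
  by auto

lemma interior_pcell: "i \<in> PI T \<Longrightarrow> interior (pcell T i) = polygon_interior (pverts T i)"
  by (simp add: pcell_def interior_polygon simple_pverts)

lemma interior_dcell: "\<nu> \<in> DI T \<Longrightarrow> interior (dcell T \<nu>) = polygon_interior (dverts T \<nu>)"
  by (simp add: dcell_def interior_polygon simple_dverts)

lemma pcenter_closure: "i \<in> PI T \<Longrightarrow> pcenter T i \<in> closure \<Omega>"
proof (cases "i \<le> Nc T")
  case True
  moreover assume "i \<in> PI T"
  ultimately have "pcenter T i \<in> pcell T i" "pcell T i \<subseteq> \<Omega>"
    using pcenter_interior pcell_inside interior_subset by (blast, auto)
  then show ?thesis using closure_subset by blast
next
  case False
  moreover assume "i \<in> PI T"
  ultimately show ?thesis using pcenter_frontier by (auto simp: frontier_def)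
qed

lemma open_nbhd_meets_domain: "open U \<Longrightarrow> x \<in> U \<Longrightarrow> x \<in> closure \<Omega> \<Longrightarrow> U \<inter> \<Omega> \<noteq> {}"
  using open_Int_closure_eq_empty by blast

lemma pcell_meets_domain:
  assumes "i \<in> PI T"
  shows "polygon_interior (pverts T i) \<inter> \<Omega> \<noteq> {}"
  using assms pcenter_interior interior_pcell pcenter_closure open_polygon_interior
  by (intro open_nbhd_meets_domain[of _ "pcenter T i"]) auto

text \<open>A common center is interior to both cells and lies in \<open>closure \<Omega>\<close>,
  so both interiors would share points of \<open>\<Omega>\<close>. Injectivity allows cell values to
  be read as values at dual vertices.\<close>

lemma inj_pcenter: "inj_on (pcenter T) (PI T)"
proof (rule inj_onI, rule ccontr)
  fix i j assume ij: "i \<in> PI T" "j \<in> PI T" "pcenter T i = pcenter T j" "i \<noteq> j"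
  have "interior (pcell T i) \<inter> interior (pcell T j) \<inter> \<Omega> \<noteq> {}"
  proof (rule open_nbhd_meets_domain)
    show "pcenter T i \<in> interior (pcell T i) \<inter> interior (pcell T j)"
      using ij(1-3) pcenter_interior by (metis IntI)
  qed (use ij(1) pcenter_closure in auto)
  then show False using pcells_disjoint ij by blast
qed

lemma dcell_subset: "\<nu> \<in> DI T \<Longrightarrow> dcell T \<nu> \<subseteq> closure \<Omega>"
  using dcells_cover by blast

lemma dcell_interior_subset:
  assumes "\<nu> \<in> DI T"
  shows "polygon_interior (dverts T \<nu>) \<subseteq> \<Omega>"
proof -
  have "interior (dcell T \<nu>) \<subseteq> interior (closure \<Omega>)"
    using dcell_subset[OF assms] by (rule interior_mono)
  then show ?thesis using assms by (simp add: interior_closure_domain interior_dcell)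
qed

lemma dedge_edge: "e \<in> EI T \<Longrightarrow> \<exists>\<nu>\<in>DI T. dedge T e \<in> polygon_edges (dverts T \<nu>)"
  using dedge_bij by (auto simp: bij_betw_def)

lemma dual_edge_index:
  assumes "\<nu> \<in> DI T" "s \<in> polygon_edges (dverts T \<nu>)"
  obtains e where "e \<in> EI T" "s = dedge T e" "\<nu> \<in> VE T e" "e \<in> EV T \<nu>"
proof -
  have "s \<in> dedge T ` EI T" using assms dedge_bij unfolding bij_betw_def by blast
  then obtain e where "e \<in> EI T" "s = dedge T e" by blast
  then show ?thesis using that[of e] assms by (simp add: VE_def EV_def)
qed

lemma primal_edge_index:
  assumes "i \<in> PI T" "s \<in> polygon_edges (pverts T i)" "s \<inter> closure \<Omega> \<noteq> {}"
  obtains e where "e \<in> EI T" "s = pedge T e" "i \<in> CE T e"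
proof -
  have "s \<in> pedge T ` EI T" using assms pedge_bij unfolding bij_betw_def by blast
  then obtain e where "e \<in> EI T" "s = pedge T e" by blast
  then show ?thesis using that[of e] assms by (simp add: CE_def EC_def)
qed

lemma dedge_subset:
  assumes "e \<in> EI T"
  shows "dedge T e \<subseteq> closure \<Omega>"
proof -
  obtain \<nu> where "\<nu> \<in> DI T" "dedge T e \<in> polygon_edges (dverts T \<nu>)"
    using dedge_edge[OF assms] by blast
  then have "dedge T e \<subseteq> dcell T \<nu>" by (auto simp: dcell_def polygon_def)
  then show ?thesis using dcell_subset \<open>\<nu> \<in> DI T\<close> by blast
qed

section \<open>Crossing points and orientation signs\<close>

lemma crossing_props:
  assumes "e \<in> EI T"
  shows "crossing T e \<in> rel_interior (pedge T e)" "crossing T e \<in> rel_interior (dedge T e)"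
    "pedge T e \<inter> dedge T e = {crossing T e}"
proof -
  obtain x where x: "x \<in> rel_interior (pedge T e) \<inter> rel_interior (dedge T e)"
      "pedge T e \<inter> dedge T e = {x}"
    using edges_cross assms by blast
  have "crossing T e = x" unfolding crossing_def x(2) by auto
  with x show "crossing T e \<in> rel_interior (pedge T e)" "crossing T e \<in> rel_interior (dedge T e)"
    "pedge T e \<inter> dedge T e = {crossing T e}" by auto
qed

text \<open>The dual edge leads from the crossing point to the cell center without meeting the boundary
  of the cell again, so the center lies on the inner side of the primary edge.\<close>

lemma ray_to_pcenter:
  assumes e: "e \<in> EI T" and i: "i \<in> CE T e"
  shows "\<forall>\<^sub>F s in at_right 0.
      crossing T e + s *\<^sub>R (pcenter T i - crossing T e) \<in> polygon_interior (pverts T i)"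
    and "pcenter T i \<in> dedge T e" and "pcenter T i \<noteq> crossing T e"
proof -
  let ?B = "\<Union>(polygon_edges (pverts T i))"
  define x where "x = crossing T e"
  have iP: "i \<in> PI T" using i CE_subset by blast
  obtain i' j' where "CE T e = {i', j'}" "dedge T e = closed_segment (pcenter T i') (pcenter T j')"
    using primal_pair e by blast
  then obtain j where dj: "dedge T e = closed_segment (pcenter T i) (pcenter T j)"
    using i closed_segment_commute by fastforce
  then show pd: "pcenter T i \<in> dedge T e" by simp
  have xd: "x \<in> dedge T e" and px: "pedge T e \<inter> dedge T e = {x}"
    using crossing_props[OF e] by (auto simp: x_def)
  \<comment> \<open>A dual edge meets no primary edge but its partner, so of all edges of the cell
    only \<open>pedge T e\<close> can be hit.\<close>
  have inB: "s = pedge T e" if s: "s \<in> polygon_edges (pverts T i)" "y \<in> s" "y \<in> dedge T e" for s y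
  proof -
    have "s \<inter> closure \<Omega> \<noteq> {}" using s dedge_subset[OF e] by blast
    then obtain e' where e': "e' \<in> EI T" "s = pedge T e'"
      using primal_edge_index[OF iP s(1)] by blast
    have "pedge T e' \<inter> dedge T e \<noteq> {}" using s(2,3) e'(2) by blast
    then have "e' = e" using edges_cross_only e e'(1) by blast
    then show ?thesis using e'(2) by simp
  qed
  have ci: "pcenter T i \<in> polygon_interior (pverts T i)"
    using pcenter_interior iP interior_pcell by blast
  then have "pcenter T i \<notin> ?B"
    unfolding polygon_interior_def using inside_no_overlap by blast
  moreover have "pedge T e \<in> polygon_edges (pverts T i)" using i by (simp add: CE_def EC_def)
  ultimately show ne: "pcenter T i \<noteq> crossing T e" using px by (auto simp: x_def)
  let ?f = "\<lambda>s. x + s *\<^sub>R (pcenter T i - x)"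
  have "?f s \<in> polygon_interior (pverts T i)" if s: "0 < s" "s \<le> 1" for s
  proof -
    let ?S = "?f ` {0<..1}"
    have "?f t \<notin> ?B" if t: "0 < t" "t \<le> 1" for t
    proof
      assume "?f t \<in> ?B"
      moreover have fd: "?f t \<in> dedge T e"
      proof -
        have "?f t = (1 - t) *\<^sub>R x + t *\<^sub>R pcenter T i" by (simp add: algebra_simps)
        also have "\<dots> \<in> dedge T e"
          using xd pd t unfolding dj by (intro convexD_alt) auto
        finally show ?thesis .
      qed
      ultimately have "?f t \<in> pedge T e" using inB by blast
      then have "?f t = x" using fd px by blast
      then show False using t ne by (simp add: x_def)
    qed
    then have "?S \<subseteq> - ?B" by auto
    moreover have "connected ?S"
      by (intro connected_continuous_image continuous_intros) auto
    moreover have "?f 1 \<in> ?S" "?f s \<in> ?S" using s by (intro imageI, simp)+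
    ultimately have "connected_component (- ?B) (?f 1) (?f s)"
      unfolding connected_component_def by (intro exI[of _ ?S]) simp
    then show ?thesis
      using ci inside_same_component by (simp add: polygon_interior_def)
  qed
  moreover have "\<forall>\<^sub>F s in at_right (0::real). s \<in> {0<..<1}"
    by (rule eventually_at_right_real) simp
  ultimately show "\<forall>\<^sub>F s in at_right 0.
      crossing T e + s *\<^sub>R (pcenter T i - crossing T e) \<in> polygon_interior (pverts T i)"
    by (auto elim!: eventually_mono simp: x_def)
qed

text \<open>The normal and the direction from the crossing point to the center are both multiples of
  \<open>perp (b - a)\<close>, and the latter enters the cell; the normal points away exactly when
  their inner product is negative.\<close>

lemma nsgn_center:
  assumes e: "e \<in> EI T" and i: "i \<in> CE T e"
  shows "nsgn T e i = - sgn (nrm T e \<bullet> (pcenter T i - crossing T e))"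
    and "nrm T e \<bullet> (pcenter T i - crossing T e) \<noteq> 0"
proof -
  define x where "x = crossing T e"
  have iP: "i \<in> PI T" using i CE_subset by blast
  have edge: "pedge T e \<in> polygon_edges (pverts T i)" using i by (simp add: CE_def EC_def)
  obtain a b where ab: "pedge T e = closed_segment a b" "a \<noteq> b"
    using polygon_edge_ends[OF simple_pverts[OF iP] edge] by blast
  then have nz: "b - a \<noteq> 0" by simp
  define p where "p = perp (b - a)"
  define v where "v = pcenter T i - x"
  have xab: "x \<in> open_segment a b"
    using crossing_props(1)[OF e] ab by (simp add: x_def rel_interior_closed_segment)
  have mem: "a \<in> pedge T e" "b \<in> pedge T e" "x \<in> dedge T e"
    using ab crossing_props[OF e] by (auto simp: x_def)
  have "nrm T e \<bullet> (b - a) = 0"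
    using nrm_props e mem by (auto simp: orthogonal_def)
  then obtain \<kappa> where \<kappa>: "nrm T e = \<kappa> *\<^sub>R p"
    unfolding p_def using perp_of_orthogonal[OF _ nz] by blast
  have "v \<bullet> (b - a) = 0"
    using edges_orthogonal e mem ray_to_pcenter(2)[OF e i]
    by (auto simp: orthogonal_def v_def inner_commute)
  then obtain \<mu> where \<mu>: "v = \<mu> *\<^sub>R p"
    unfolding p_def using perp_of_orthogonal[OF _ nz] by blast
  have p: "0 < p \<bullet> p" using ab(2) by (simp add: p_def)
  have "norm (nrm T e) = 1" using nrm_props e by blast
  then have k0: "\<kappa> \<noteq> 0" using \<kappa> by auto
  have "v \<noteq> 0" using ray_to_pcenter(3)[OF e i] by (simp add: v_def x_def)
  then have l0: "\<mu> \<noteq> 0" using \<mu> by auto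
  have "points_away x (nrm T e) (polygon (pverts T i)) \<longleftrightarrow> (nrm T e \<bullet> p) * (v \<bullet> p) < 0"
    unfolding p_def
  proof (rule points_away_polygon_iff[OF simple_pverts[OF iP] _ xab])
    show "closed_segment a b \<in> polygon_edges (pverts T i)" using edge ab by simp
    show "nrm T e \<bullet> perp (b - a) \<noteq> 0" "v \<bullet> perp (b - a) \<noteq> 0"
      using \<kappa> \<mu> k0 l0 p by (auto simp: p_def)
    show "\<forall>\<^sub>F s in at_right 0. x + s *\<^sub>R v \<in> polygon_interior (pverts T i)"
      using ray_to_pcenter(1)[OF e i] by (simp add: x_def v_def)
  qed
  also have "\<dots> \<longleftrightarrow> nrm T e \<bullet> v < 0"
    using p by (auto simp: \<kappa> \<mu> mult_less_0_iff zero_less_mult_iff)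
  finally have away: "points_away x (nrm T e) (pcell T i) \<longleftrightarrow> nrm T e \<bullet> v < 0"
    by (simp add: pcell_def)
  show nz: "nrm T e \<bullet> (pcenter T i - crossing T e) \<noteq> 0"
    using p k0 l0 \<kappa> \<mu> by (auto simp: v_def x_def)
  show "nsgn T e i = - sgn (nrm T e \<bullet> (pcenter T i - crossing T e))"
    using away nz by (auto simp: nsgn_def x_def v_def sgn_if)
qed

text \<open>The crossing point lies strictly between the two centers, so the sign can be read off
  from the dual edge directed from \<open>i\<close> to \<open>j\<close>. This form matches
  \<open>tsgn_edge\<close>, for the cancellation in \<open>curl_grad\<close>.\<close>

lemma nsgn_neighbour:
  assumes e: "e \<in> EI T" and ij: "CE T e = {i, j}" "i \<noteq> j"
  shows "nsgn T e i = sgn (nrm T e \<bullet> (pcenter T j - pcenter T i))"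
    and "nrm T e \<bullet> (pcenter T j - pcenter T i) \<noteq> 0"
    and "dedge T e = closed_segment (pcenter T i) (pcenter T j)"
proof -
  define x where "x = crossing T e"
  obtain i' j' where "CE T e = {i', j'}"
      and d': "dedge T e = closed_segment (pcenter T i') (pcenter T j')"
    using primal_pair e by blast
  then have "i = i' \<and> j = j' \<or> i = j' \<and> j = i'"
    using ij(1) by (simp add: doubleton_eq_iff)
  then show d: "dedge T e = closed_segment (pcenter T i) (pcenter T j)"
    using d' closed_segment_commute by metis
  have "{i, j} \<subseteq> PI T" unfolding ij(1)[symmetric] by (rule CE_subset)
  then have "i \<in> PI T" "j \<in> PI T" by simp_all
  then have ne: "pcenter T i \<noteq> pcenter T j" using inj_pcenter ij(2) inj_onD by metis
  then have "x \<in> open_segment (pcenter T i) (pcenter T j)"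
    using crossing_props(2)[OF e] d by (simp add: x_def rel_interior_closed_segment)
  then obtain t where t: "0 < t" "t < 1" "x = (1 - t) *\<^sub>R pcenter T i + t *\<^sub>R pcenter T j"
    by (auto simp: in_segment)
  have "pcenter T i - x = (- t) *\<^sub>R (pcenter T j - pcenter T i)"
    unfolding t(3) by (simp add: algebra_simps)
  then have *: "nrm T e \<bullet> (pcenter T i - crossing T e) = - t * (nrm T e \<bullet> (pcenter T j - pcenter T i))"
    by (metis inner_scaleR_right x_def)
  have "i \<in> CE T e" using ij(1) by simp
  from nsgn_center[OF e this, unfolded *] t(1)
  show "nsgn T e i = sgn (nrm T e \<bullet> (pcenter T j - pcenter T i))"
    "nrm T e \<bullet> (pcenter T j - pcenter T i) \<noteq> 0"
    by (auto simp add: sgn_mult)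
qed

lemma grad_pair:
  assumes e: "e \<in> EI T" and ij: "CE T e = {i, j}" "i \<noteq> j"
  shows "(\<Sum>k\<in>CE T e. \<phi> k * nsgn T e k)
    = (\<phi> i - \<phi> j) * sgn (nrm T e \<bullet> (pcenter T j - pcenter T i))"
proof -
  have "nrm T e \<bullet> (pcenter T i - pcenter T j) = - (nrm T e \<bullet> (pcenter T j - pcenter T i))"
    by (simp add: inner_diff_right)
  moreover have "CE T e = {j, i}" unfolding ij(1) by (rule insert_commute)
  ultimately have "nsgn T e j = - sgn (nrm T e \<bullet> (pcenter T j - pcenter T i))"
    using nsgn_neighbour(1)[OF e, of j i] ij(2) by (simp add: sgn_minus)
  then show ?thesis
    unfolding ij(1) using ij(2) nsgn_neighbour(1)[OF e ij] by (simp add: left_diff_distrib)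
qed

text \<open>Counterclockwise order puts the cell to the left of the edge from \<open>a\<close> to
  \<open>b\<close>, so \<open>perp (b - a)\<close> is the reference direction. As
  \<open>perp\<close> preserves inner products, the tangent can be traded for the normal.\<close>

lemma tsgn_edge:
  assumes \<nu>: "\<nu> \<in> DI T" and e: "e \<in> EI T" and k: "k < length (dverts T \<nu>)"
    and ab: "a = dverts T \<nu> ! k" "b = nxt (dverts T \<nu>) k" and d: "dedge T e = closed_segment a b"
    and nab: "nrm T e \<bullet> (b - a) \<noteq> 0"
  shows "tsgn T e \<nu> = - sgn (nrm T e \<bullet> (b - a))"
proof -
  define x where "x = crossing T e"
  have "a \<noteq> b" using nab by auto
  then have x: "x \<in> open_segment a b"
    using crossing_props(2)[OF e] d by (simp add: x_def rel_interior_closed_segment)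
  have "points_away x (tng T e) (polygon (dverts T \<nu>))
      \<longleftrightarrow> (tng T e \<bullet> perp (b - a)) * (perp (b - a) \<bullet> perp (b - a)) < 0"
  proof (rule points_away_polygon_iff[OF simple_dverts[OF \<nu>] _ x])
    show "closed_segment a b \<in> polygon_edges (dverts T \<nu>)" using k ab by (auto simp: polygon_edges_def)
    show "tng T e \<bullet> perp (b - a) \<noteq> 0" using nab by (simp add: tng_def)
    show "perp (b - a) \<bullet> perp (b - a) \<noteq> 0" using \<open>a \<noteq> b\<close> by simp
    show "\<forall>\<^sub>F s in at_right 0. x + s *\<^sub>R perp (b - a) \<in> polygon_interior (dverts T \<nu>)"
      using dverts_ccw \<nu> k x ab by (auto simp: ccw_polygon_def)
  qed
  also have "\<dots> \<longleftrightarrow> nrm T e \<bullet> (b - a) < 0"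
  proof -
    have "0 < (b - a) \<bullet> (b - a)" using \<open>a \<noteq> b\<close> by simp
    then show ?thesis unfolding tng_def perp_inner_perp by (meson mult_less_0_iff less_asym)
  qed
  finally show ?thesis
    using nab by (auto simp: tsgn_def dcell_def x_def sgn_if)
qed

end

lemma sum_cyclic_shift:
  assumes "0 < length vs"
  shows "(\<Sum>k<length vs. f (nxt vs k)) = (\<Sum>k<length vs. f (vs ! k))"
proof -
  obtain m where m: "length vs = Suc m" using assms by (metis gr0_conv_Suc)
  have "(\<Sum>k<length vs. f (nxt vs k)) = (\<Sum>k<m. f (vs ! Suc k)) + f (vs ! 0)"
    unfolding m by (simp add: m)
  also have "\<dots> = (\<Sum>k<length vs. f (vs ! k))"
    unfolding m sum.lessThan_Suc_shift by (rule add.commute)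
  finally show ?thesis .
qed

context staggered_domain
begin

section \<open>Curl of a gradient, and the kernels of the two gradients\<close>

lemma tsgn_nonzero: "tsgn T e \<nu> \<noteq> 0"
  by (simp add: tsgn_def)

text \<open>Both signs carry the factor \<open>sgn (nrm T e \<bullet> (b - a))\<close>, whose square
  is 1: the arbitrary choice of the normal drops out, and each edge contributes the value at its
  start minus that at its end along the vertex list.\<close>

lemma curl_grad:
  assumes \<nu>: "\<nu> \<in> DI T"
  shows "curl_h T (grad_h T \<phi>) \<nu> = 0"
proof -
  define vs where "vs = dverts T \<nu>"
  have vs: "simple_polygon vs" using simple_dverts[OF \<nu>] by (simp add: vs_def)
  then have len: "3 \<le> length vs" "distinct vs" by (auto simp: simple_polygon_def)
  let ?seg = "\<lambda>k. closed_segment (vs ! k) (nxt vs k)"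
  \<comment> \<open>Equal edges at two positions would share infinitely many points, while a simple
    polygon allows only vertices. So positions in the vertex list count each edge once.\<close>
  have "inj_on ?seg {..<length vs}"
  proof (rule inj_onI)
    fix j k assume jk: "j \<in> {..<length vs}" "k \<in> {..<length vs}" "?seg j = ?seg k"
    show "j = k"
    proof (rule ccontr)
      assume "j \<noteq> k"
      with jk vs have "?seg j \<inter> ?seg k \<subseteq> {vs ! j, nxt vs j} \<inter> {vs ! k, nxt vs k}"
        unfolding simple_polygon_def by blast
      then have "finite (?seg j \<inter> ?seg k)" by (rule finite_subset) simp
      then have "finite (?seg j)" by (simp only: jk(3) Int_absorb)
      moreover have "vs ! j \<noteq> nxt vs j" using simple_polygon_nxt_neq[OF vs] jk(1) by simp
      ultimately show False by (simp add: finite_closed_segment)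
    qed
  qed
  moreover have "?seg ` {..<length vs} = polygon_edges vs" by (auto simp: polygon_edges_def)
  ultimately have seg: "bij_betw ?seg {..<length vs} (polygon_edges vs)"
    by (simp add: bij_betw_def)
  have "dedge T ` EV T \<nu> = polygon_edges vs"
  proof
    show "polygon_edges vs \<subseteq> dedge T ` EV T \<nu>"
      using dual_edge_index[OF \<nu>] by (auto simp: vs_def)
  qed (auto simp: EV_def vs_def)
  moreover have "EV T \<nu> \<subseteq> EI T" by (auto simp: EV_def)
  then have "inj_on (dedge T) (EV T \<nu>)"
    by (rule inj_on_subset[OF bij_betw_imp_inj_on[OF dedge_bij]])
  ultimately have de: "bij_betw (dedge T) (EV T \<nu>) (polygon_edges vs)"
    by (simp add: bij_betw_def)
  define h where "h k = inv_into (EV T \<nu>) (dedge T) (?seg k)" for k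
  have h: "bij_betw h {..<length vs} (EV T \<nu>)"
    unfolding h_def using bij_betw_trans[OF seg bij_betw_inv_into[OF de]] by (simp add: comp_def)
  \<comment> \<open>Cell values carried to the cell centers, which are the vertices of the dual
    cell.\<close>
  define \<phi>' where "\<phi>' v = \<phi> (inv_into (PI T) (pcenter T) v)" for v
  have \<phi>': "\<phi>' (pcenter T i) = \<phi> i" if "i \<in> PI T" for i
    using that inj_pcenter by (simp add: \<phi>'_def)
  define H where "H e = grad_h T \<phi> e * dlen T e * tsgn T e \<nu>" for e
  have H: "H (h k) = \<phi>' (vs ! k) - \<phi>' (nxt vs k)" if k: "k < length vs" for k
  proof -
    define e where "e = h k"
    define a where "a = vs ! k"
    define b where "b = nxt vs k"
    have eEV: "e \<in> EV T \<nu>" using h k by (auto simp: e_def bij_betw_def)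
    then have e: "e \<in> EI T" by (simp add: EV_def)
    have "?seg k \<in> dedge T ` EV T \<nu>"
      using k bij_betw_imp_surj_on[OF de] by (auto simp: polygon_edges_def)
    then have d: "dedge T e = closed_segment a b"
      unfolding e_def h_def a_def b_def by (rule f_inv_into_f)
    obtain i' j' where "i' \<noteq> j'" "CE T e = {i', j'}"
        "dedge T e = closed_segment (pcenter T i') (pcenter T j')"
      using primal_pair e by blast
    moreover from this have "{a, b} = {pcenter T i', pcenter T j'}" using d by simp
    then have "a = pcenter T i' \<and> b = pcenter T j' \<or> a = pcenter T j' \<and> b = pcenter T i'"
      by (simp add: doubleton_eq_iff)
    ultimately obtain i j where ij: "i \<noteq> j" "CE T e = {i, j}" and ab: "a = pcenter T i" "b = pcenter T j"
      by (metis insert_commute)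
    have "{i, j} \<subseteq> PI T" unfolding ij(2)[symmetric] by (rule CE_subset)
    then have ijP: "i \<in> PI T" "j \<in> PI T" by simp_all
    have nz: "nrm T e \<bullet> (b - a) \<noteq> 0" using nsgn_neighbour(2)[OF e ij(2,1)] by (simp add: ab)
    have "tsgn T e \<nu> = - sgn (nrm T e \<bullet> (b - a))"
      using k d nz by (intro tsgn_edge[OF \<nu> e, of k]) (auto simp: a_def b_def vs_def)
    moreover have "(\<Sum>k\<in>CE T e. \<phi> k * nsgn T e k) = (\<phi> i - \<phi> j) * sgn (nrm T e \<bullet> (b - a))"
      using grad_pair[OF e ij(2,1)] by (simp add: ab)
    moreover have "sgn (nrm T e \<bullet> (b - a)) * sgn (nrm T e \<bullet> (b - a)) = 1"
      using nz by (simp add: sgn_if)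
    ultimately have "H e = \<phi> i - \<phi> j"
      using dlen_pos[OF e] by (simp add: H_def grad_h_def)
    then show ?thesis using \<phi>' ijP by (simp add: e_def[symmetric] a_def[symmetric] b_def[symmetric] ab)
  qed
  have "(\<Sum>e\<in>EV T \<nu>. H e) = (\<Sum>k<length vs. H (h k))"
    using sum.reindex_bij_betw[OF h, of H] by simp
  also have "\<dots> = (\<Sum>k<length vs. \<phi>' (vs ! k)) - (\<Sum>k<length vs. \<phi>' (nxt vs k))"
    using H by (simp add: sum_subtractf)
  also have "\<dots> = 0" 
  proof -
    have "0 < length vs" using len(1) by linarith
    then show ?thesis by (simp only: sum_cyclic_shift diff_self)
  qed
  finally show ?thesis by (simp add: curl_h_def H_def)
qed

lemma grad_zero_pair:
  assumes "e \<in> EI T" "CE T e = {i, j}" "i \<noteq> j"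
  shows "grad_h T \<phi> e = 0 \<longleftrightarrow> \<phi> i = \<phi> j"
  unfolding grad_h_def grad_pair[OF assms]
  using nsgn_neighbour(2)[OF assms] dlen_pos[OF assms(1)] by (simp add: sgn_eq_0_iff)

text \<open>With the level set of the value \<open>\<phi> i\<close> as colour, a zero gradient gives
  the two cells at an edge the same colour, and \<open>polygon_cover_colouring\<close> spreads it
  everywhere.\<close>

lemma grad_zero_const:
  assumes zero: "\<And>e. e \<in> EI T \<Longrightarrow> grad_h T \<phi> e = 0" and ij: "i \<in> PI T" "j \<in> PI T"
  shows "\<phi> j = \<phi> i"
proof -
  let ?Z = "{k. \<phi> k = \<phi> i}"
  have "j \<in> ?Z"
  proof (rule polygon_cover_colouring[of "PI T" \<Omega> "pverts T" ?Z i])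
    show "\<Omega> \<subseteq> (\<Union>i\<in>PI T. polygon (pverts T i))"
      using pcells_cover closure_subset[of \<Omega>] by (auto simp: pcell_def)
    show "polygon_interior (pverts T k) \<inter> polygon_interior (pverts T l) \<inter> \<Omega> = {}"
      if "k \<in> PI T" "l \<in> PI T" "k \<noteq> l" for k l
      using pcells_disjoint that interior_pcell by blast
    show "\<exists>l\<in>PI T. l \<noteq> k \<and> s \<in> polygon_edges (pverts T l) \<and> (k \<in> ?Z \<longleftrightarrow> l \<in> ?Z)"
      if k: "k \<in> PI T" and s: "s \<in> polygon_edges (pverts T k)" "s \<inter> \<Omega> \<noteq> {}" for k s
    proof -
      have "s \<inter> closure \<Omega> \<noteq> {}" using s(2) closure_subset[of \<Omega>] by blast
      then obtain e where e: "e \<in> EI T" "s = pedge T e" "k \<in> CE T e"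
        using primal_edge_index[OF k s(1)] by blast
      obtain i' j' where CE: "i' \<noteq> j'" "CE T e = {i', j'}" using primal_pair e(1) by blast
      have eq: "\<phi> i' = \<phi> j'" using grad_zero_pair[OF e(1) CE(2,1)] zero[OF e(1)] by simp
      obtain l where l: "l \<in> CE T e" "l \<noteq> k" "\<phi> l = \<phi> k"
        using e(3) CE eq by (metis insert_iff singletonD)
      then have "l \<in> PI T" "s \<in> polygon_edges (pverts T l)"
        using e(2) by (simp_all add: CE_def EC_def)
      then show ?thesis using l by auto
    qed
  qed (use ij pcell_meets_domain simple_pverts open_domain connected_domain in auto)
  then show ?thesis by simp
qed

text \<open>A frontier point that is not a dual vertex lies in a dual cell but not in its interior,
  hence in the relative interior of a dual edge. An interior pair would place it in
  \<open>\<Omega>\<close>.\<close>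

lemma boundary_edge_exists: "\<exists>e\<in>{Ne T + 1..Ne T + Neb T}. True"
proof -
  define F where "F = (\<Union>\<nu>\<in>DI T. set (dverts T \<nu>))"
  have "finite F" by (simp add: F_def)
  then have "\<not> frontier \<Omega> \<subseteq> F" using infinite_frontier_domain finite_subset by blast
  then obtain x where x: "x \<in> frontier \<Omega>" "x \<notin> F" by blast
  then have xo: "x \<notin> \<Omega>" and "x \<in> closure \<Omega>"
    using open_domain by (auto simp: frontier_def interior_open)
  then obtain \<nu> where \<nu>: "\<nu> \<in> DI T" "x \<in> dcell T \<nu>" using dcells_cover by blast
  have "x \<notin> polygon_interior (dverts T \<nu>)" using dcell_interior_subset[OF \<nu>(1)] xo by blast
  then obtain s where s: "s \<in> polygon_edges (dverts T \<nu>)" "x \<in> s"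
    using \<nu>(2) by (auto simp: dcell_def polygon_def)
  obtain k where k: "k < length (dverts T \<nu>)" "s = closed_segment (dverts T \<nu> ! k) (nxt (dverts T \<nu>) k)"
    "dverts T \<nu> ! k \<noteq> nxt (dverts T \<nu>) k"
    using polygon_edge_ends[OF simple_dverts[OF \<nu>(1)] s(1)] by blast
  have "0 < length (dverts T \<nu>)" using k(1) by linarith
  then have "dverts T \<nu> ! k \<in> F" "nxt (dverts T \<nu>) k \<in> F"
    using \<nu>(1) k(1) by (auto simp: F_def intro!: bexI[of _ \<nu>])
  then have "x \<in> rel_interior s"
    using k x(2) s(2) by (auto simp: rel_interior_closed_segment open_segment_def)
  moreover obtain e where e: "e \<in> EI T" "s = dedge T e" using dual_edge_index[OF \<nu>(1) s(1)] by blast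
  ultimately have "e \<notin> {1..Ne T}" using interior_pair xo by blast
  then show ?thesis using EI_split[OF e(1)] by blast
qed

text \<open>The colour is nonvanishing instead of a level set: across an interior edge the two
  values are related by nonzero factors, whatever the signs, and a boundary edge, with a single dual
  cell, forces a zero.\<close>

lemma perp_grad_zero:
  assumes zero: "\<And>e. e \<in> EI T \<Longrightarrow> perp_grad_h \<Omega> T \<psi> e = 0" and \<nu>: "\<nu> \<in> DI T"
  shows "\<psi> \<nu> = 0"
proof (rule ccontr)
  assume nz: "\<psi> \<nu> \<noteq> 0"
  have sum0: "(\<Sum>\<nu>\<in>VE T e. \<psi> \<nu> * tsgn T e \<nu>) = 0" if "e \<in> EI T" for e
    using zero[OF that] plen_pos[OF that] by (simp add: perp_grad_h_def)
  let ?Z = "{\<mu>. \<psi> \<mu> \<noteq> 0}"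
  have all: "\<mu> \<in> ?Z" if \<mu>: "\<mu> \<in> DI T" for \<mu>
  proof (rule polygon_cover_colouring[of "DI T" \<Omega> "dverts T" ?Z \<nu>])
    show "\<Omega> \<subseteq> (\<Union>\<nu>\<in>DI T. polygon (dverts T \<nu>))"
      using dcells_cover closure_subset[of \<Omega>] by (auto simp: dcell_def)
    show "polygon_interior (dverts T k) \<inter> polygon_interior (dverts T l) \<inter> \<Omega> = {}"
      if "k \<in> DI T" "l \<in> DI T" "k \<noteq> l" for k l
      using dcells_disjoint that interior_dcell by blast
    show "polygon_interior (dverts T k) \<inter> \<Omega> \<noteq> {}" if "k \<in> DI T" for k
      using dcell_interior_subset[OF that] simple_polygon_Jordan(1)[OF simple_dverts[OF that]] by blast
    show "\<exists>l\<in>DI T. l \<noteq> k \<and> s \<in> polygon_edges (dverts T l) \<and> (k \<in> ?Z \<longleftrightarrow> l \<in> ?Z)"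
      if k: "k \<in> DI T" and s: "s \<in> polygon_edges (dverts T k)" "s \<inter> \<Omega> \<noteq> {}" for k s
    proof -
      obtain e where e: "e \<in> EI T" "s = dedge T e" "k \<in> VE T e"
        using dual_edge_index[OF k s(1)] by blast
      have "\<not> dedge T e \<subseteq> frontier \<Omega>"
        using s(2) e(2) open_domain by (auto simp: frontier_def interior_open)
      then have "e \<notin> {Ne T + 1..Ne T + Neb T}" using boundary_pair by blast
      then have "e \<in> {1..Ne T}" using EI_split[OF e(1)] by blast
      then obtain i' j' where VE: "i' \<noteq> j'" "VE T e = {i', j'}" using interior_pair by blast
      have "\<psi> i' * tsgn T e i' + \<psi> j' * tsgn T e j' = 0"
        using sum0[OF e(1)] VE by simp
      then have eq: "\<psi> i' = 0 \<longleftrightarrow> \<psi> j' = 0"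
        using tsgn_nonzero[of e i'] tsgn_nonzero[of e j'] by auto
      obtain l where l: "l \<in> VE T e" "l \<noteq> k" "\<psi> l = 0 \<longleftrightarrow> \<psi> k = 0"
        using e(3) VE eq by (metis insert_iff singletonD)
      then have "l \<in> DI T" "s \<in> polygon_edges (dverts T l)"
        using e(2) by (simp_all add: VE_def EV_def)
      then show ?thesis using l by auto
    qed
  qed (use nz \<nu> \<mu> simple_dverts open_domain connected_domain in auto)
  obtain e where e: "e \<in> {Ne T + 1..Ne T + Neb T}" using boundary_edge_exists by blast
  then obtain \<mu> where \<mu>: "VE T e = {\<mu>}" using boundary_pair by blast
  have "e \<in> EI T" using e by auto
  from sum0[OF this] have "\<psi> \<mu> = 0" using \<mu> tsgn_nonzero by simp
  moreover have "{\<mu>} \<subseteq> DI T" unfolding \<mu>[symmetric] by (rule VE_subset)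
  ultimately show False using all by simp
qed

section \<open>Discrete Helmholtz decomposition and the Stokes problem\<close>

lemma lmeasurable_pcell_part: "pcell T i \<inter> \<Omega> \<in> lmeasurable"
  and lmeasurable_dcell: "dcell T \<nu> \<in> lmeasurable"
  using open_domain bounded_domain
  by (auto simp: pcell_def dcell_def compact_polygon lmeasurable_compact lmeasurable_open
      intro!: fmeasurable.Int)

lemma parea_pos:
  assumes "i \<in> PI T"
  shows "0 < parea \<Omega> T i"
proof -
  have "open (polygon_interior (pverts T i) \<inter> \<Omega>)"
    by (simp add: open_Int open_domain open_polygon_interior)
  then have "\<not> negligible (polygon_interior (pverts T i) \<inter> \<Omega>)"
    using pcell_meets_domain[OF assms] open_not_negligible by blast
  then have "\<not> negligible (pcell T i \<inter> \<Omega>)"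
    by (rule contrapos_nn) (erule negligible_subset, auto simp: pcell_def polygon_def)
  then have "parea \<Omega> T i \<noteq> 0"
    using negligible_iff_measure0[OF lmeasurable_pcell_part] by (simp add: parea_def)
  then show ?thesis by (simp add: parea_def less_le)
qed

lemma darea_pos:
  assumes "\<nu> \<in> DI T"
  shows "0 < darea T \<nu>"
proof -
  have "\<not> negligible (polygon_interior (dverts T \<nu>))"
    using simple_polygon_Jordan(1)[OF simple_dverts[OF assms]] open_not_negligible
      open_polygon_interior by blast
  then have "\<not> negligible (dcell T \<nu>)"
    by (rule contrapos_nn) (erule negligible_subset, auto simp: dcell_def polygon_def)
  then have "darea T \<nu> \<noteq> 0"
    using negligible_iff_measure0[OF lmeasurable_dcell] by (simp add: darea_def)
  then show ?thesis by (simp add: darea_def less_le)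
qed

text \<open>Twice the area of the diamond of the pair, so the weighted sums are twice the
  \<open>L2\<close> products of the fields.\<close>

abbreviation weight :: "nat \<Rightarrow> real" where "weight e \<equiv> plen \<Omega> T e * dlen T e"

lemma weight_pos: "e \<in> EI T \<Longrightarrow> 0 < weight e"
  by (intro mult_pos_pos plen_pos dlen_pos)

section \<open>Summation by parts\<close>

lemma grad_adjoint:
  "(\<Sum>e\<in>EI T. weight e * v e * grad_h T \<phi> e) = - (\<Sum>i\<in>PI T. \<phi> i * (parea \<Omega> T i * div_h \<Omega> T v i))"
proof -
  have "(\<Sum>e\<in>EI T. weight e * v e * grad_h T \<phi> e)
      = (\<Sum>e\<in>EI T. \<Sum>i | i \<in> PI T \<and> e \<in> EC T i. - (\<phi> i * (v e * plen \<Omega> T e * nsgn T e i)))"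
  proof (rule sum.cong[OF refl])
    fix e assume "e \<in> EI T"
    then have "weight e * v e * grad_h T \<phi> e = - (plen \<Omega> T e * v e) * (\<Sum>i\<in>CE T e. \<phi> i * nsgn T e i)"
      using dlen_pos[of e] by (simp add: grad_h_def)
    then show "weight e * v e * grad_h T \<phi> e
        = (\<Sum>i | i \<in> PI T \<and> e \<in> EC T i. - (\<phi> i * (v e * plen \<Omega> T e * nsgn T e i)))"
      by (simp add: CE_def sum_distrib_left sum_negf mult_ac)
  qed
  also have "\<dots> = (\<Sum>i\<in>PI T. \<Sum>e | e \<in> EI T \<and> e \<in> EC T i. - (\<phi> i * (v e * plen \<Omega> T e * nsgn T e i)))"
    by (rule sum.swap_restrict) auto
  also have "\<dots> = (\<Sum>i\<in>PI T. - (\<phi> i * (parea \<Omega> T i * div_h \<Omega> T v i)))"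
  proof (rule sum.cong[OF refl])
    fix i assume "i \<in> PI T"
    moreover have "{e. e \<in> EI T \<and> e \<in> EC T i} = EC T i" by (auto simp: EC_def)
    ultimately show "(\<Sum>e | e \<in> EI T \<and> e \<in> EC T i. - (\<phi> i * (v e * plen \<Omega> T e * nsgn T e i)))
        = - (\<phi> i * (parea \<Omega> T i * div_h \<Omega> T v i))"
      using parea_pos[of i] by (simp add: div_h_def sum_distrib_left sum_negf)
  qed
  finally show ?thesis by (simp add: sum_negf)
qed

lemma perp_grad_adjoint:
  "(\<Sum>e\<in>EI T. weight e * v e * perp_grad_h \<Omega> T \<psi> e) = - (\<Sum>\<nu>\<in>DI T. darea T \<nu> * \<psi> \<nu> * curl_h T v \<nu>)"
proof -
  have "(\<Sum>e\<in>EI T. weight e * v e * perp_grad_h \<Omega> T \<psi> e)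
      = (\<Sum>e\<in>EI T. \<Sum>\<nu> | \<nu> \<in> DI T \<and> e \<in> EV T \<nu>. \<psi> \<nu> * (v e * dlen T e * tsgn T e \<nu>))"
  proof (rule sum.cong[OF refl])
    fix e assume "e \<in> EI T"
    then have "weight e * v e * perp_grad_h \<Omega> T \<psi> e = dlen T e * v e * (\<Sum>\<nu>\<in>VE T e. \<psi> \<nu> * tsgn T e \<nu>)"
      using plen_pos[of e] by (simp add: perp_grad_h_def)
    then show "weight e * v e * perp_grad_h \<Omega> T \<psi> e
        = (\<Sum>\<nu> | \<nu> \<in> DI T \<and> e \<in> EV T \<nu>. \<psi> \<nu> * (v e * dlen T e * tsgn T e \<nu>))"
      by (simp add: VE_def sum_distrib_left mult_ac)
  qed
  also have "\<dots> = (\<Sum>\<nu>\<in>DI T. \<Sum>e | e \<in> EI T \<and> e \<in> EV T \<nu>. \<psi> \<nu> * (v e * dlen T e * tsgn T e \<nu>))"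
    by (rule sum.swap_restrict) auto
  also have "\<dots> = (\<Sum>\<nu>\<in>DI T. - (darea T \<nu> * \<psi> \<nu> * curl_h T v \<nu>))"
  proof (rule sum.cong[OF refl])
    fix \<nu> assume "\<nu> \<in> DI T"
    moreover have "{e. e \<in> EI T \<and> e \<in> EV T \<nu>} = EV T \<nu>" by (auto simp: EV_def)
    ultimately show "(\<Sum>e | e \<in> EI T \<and> e \<in> EV T \<nu>. \<psi> \<nu> * (v e * dlen T e * tsgn T e \<nu>))
        = - (darea T \<nu> * \<psi> \<nu> * curl_h T v \<nu>)"
      using darea_pos[of \<nu>] by (simp add: curl_h_def sum_distrib_left sum_negf mult_ac)
  qed
  finally show ?thesis by (simp add: sum_negf)
qed

section \<open>Linearity of the operators and of \<open>V_h\<close>\<close>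

lemma curl_h_cong: "(\<And>e. e \<in> EI T \<Longrightarrow> u e = v e) \<Longrightarrow> curl_h T u \<nu> = curl_h T v \<nu>"
  unfolding curl_h_def by (intro arg_cong2[where f = "(*)"] sum.cong) (auto simp: EV_def)

lemma curl_h_sum: "curl_h T (\<lambda>e. \<Sum>k\<in>A. c k * u k e) \<nu> = (\<Sum>k\<in>A. c k * curl_h T (u k) \<nu>)"
proof -
  have "(\<Sum>e\<in>EV T \<nu>. (\<Sum>k\<in>A. c k * u k e) * dlen T e * tsgn T e \<nu>)
      = (\<Sum>k\<in>A. c k * (\<Sum>e\<in>EV T \<nu>. u k e * dlen T e * tsgn T e \<nu>))"
    unfolding sum_distrib_right sum_distrib_left by (subst sum.swap) (simp add: mult_ac)
  then show ?thesis unfolding curl_h_def by (simp add: sum_distrib_left mult_ac)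
qed

lemma div_h_sum: "div_h \<Omega> T (\<lambda>e. \<Sum>k\<in>A. c k * u k e) i = (\<Sum>k\<in>A. c k * div_h \<Omega> T (u k) i)"
proof -
  have "(\<Sum>e\<in>EC T i. (\<Sum>k\<in>A. c k * u k e) * plen \<Omega> T e * nsgn T e i)
      = (\<Sum>k\<in>A. c k * (\<Sum>e\<in>EC T i. u k e * plen \<Omega> T e * nsgn T e i))"
    unfolding sum_distrib_right sum_distrib_left by (subst sum.swap) (simp add: mult_ac)
  then show ?thesis unfolding div_h_def by (simp add: sum_distrib_left mult_ac)
qed

lemma grad_h_sum: "grad_h T (\<lambda>e. \<Sum>k\<in>A. c k * u k e) i = (\<Sum>k\<in>A. c k * grad_h T (u k) i)"
proof -
  have "(\<Sum>e\<in>CE T i. (\<Sum>k\<in>A. c k * u k e) * nsgn T i e)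
      = (\<Sum>k\<in>A. c k * (\<Sum>e\<in>CE T i. u k e * nsgn T i e))"
    unfolding sum_distrib_right sum_distrib_left by (subst sum.swap) (simp add: mult_ac)
  then show ?thesis unfolding grad_h_def by (simp add: sum_distrib_left mult_ac)
qed

lemma curl_h_add: "curl_h T (\<lambda>e. u e + v e) \<nu> = curl_h T u \<nu> + curl_h T v \<nu>"
  by (simp add: curl_h_def algebra_simps sum.distrib add_divide_distrib)

lemma curl_h_diff: "curl_h T (\<lambda>e. u e - v e) \<nu> = curl_h T u \<nu> - curl_h T v \<nu>"
  by (simp add: curl_h_def algebra_simps sum_subtractf diff_divide_distrib)

lemma div_h_diff: "div_h \<Omega> T (\<lambda>e. u e - v e) i = div_h \<Omega> T u i - div_h \<Omega> T v i"
  by (simp add: div_h_def algebra_simps sum_subtractf diff_divide_distrib)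

lemma grad_h_diff: "grad_h T (\<lambda>i. p i - q i) e = grad_h T p e - grad_h T q e"
  by (simp add: grad_h_def algebra_simps sum_subtractf diff_divide_distrib)

lemma perp_grad_h_diff: "perp_grad_h \<Omega> T (\<lambda>i. p i - q i) e = perp_grad_h \<Omega> T p e - perp_grad_h \<Omega> T q e"
  by (simp add: perp_grad_h_def algebra_simps sum_subtractf diff_divide_distrib)

lemma perp_grad_h_uminus: "perp_grad_h \<Omega> T (\<lambda>i. - p i) e = - perp_grad_h \<Omega> T p e"
  by (simp add: perp_grad_h_def sum_negf)

lemma V_h_diff: "u \<in> V_h \<Omega> T \<Longrightarrow> v \<in> V_h \<Omega> T \<Longrightarrow> (\<lambda>e. u e - v e) \<in> V_h \<Omega> T"
  by (auto simp: V_h_def div_h_diff)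

lemma V_h_sum: "(\<And>k. k \<in> A \<Longrightarrow> u k \<in> V_h \<Omega> T) \<Longrightarrow> (\<lambda>e. \<Sum>k\<in>A. c k * u k e) \<in> V_h \<Omega> T"
  by (auto simp: V_h_def div_h_sum)

text \<open>Elements of \<open>V_h\<close> vanish on boundary edges, so the adjoint formulas over
  all edges apply to equations imposed on interior edges.\<close>

lemma sum_V_h:
  assumes "v \<in> V_h \<Omega> T"
  shows "(\<Sum>e\<in>EI T. weight e * v e * f e) = (\<Sum>e\<in>{1..Ne T}. weight e * v e * f e)"
  using assms by (intro sum.mono_neutral_right) (auto simp: V_h_def)

lemma V_h_grad:
  assumes "v \<in> V_h \<Omega> T"
  shows "(\<Sum>e\<in>{1..Ne T}. weight e * v e * grad_h T \<phi> e) = 0"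
  unfolding sum_V_h[OF assms, symmetric] grad_adjoint using assms by (simp add: V_h_def)

lemma V_h_perp_grad:
  assumes "v \<in> V_h \<Omega> T"
  shows "(\<Sum>e\<in>{1..Ne T}. weight e * v e * perp_grad_h \<Omega> T \<psi> e)
    = - (\<Sum>\<nu>\<in>DI T. darea T \<nu> * \<psi> \<nu> * curl_h T v \<nu>)"
  unfolding sum_V_h[OF assms, symmetric] by (rule perp_grad_adjoint)

lemma weighted_square_zero:
  assumes "A \<subseteq> EI T" "(\<Sum>e\<in>A. weight e * v e * v e) = 0" "e \<in> A"
  shows "v e = 0"
proof -
  have "finite A" using assms(1) by (rule finite_subset) simp
  moreover have "0 \<le> weight x * v x * v x" if "x \<in> A" for x
  proof -
    have "0 < weight x" using assms(1) that by (intro weight_pos) blast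
    from mult_nonneg_nonneg[OF less_imp_le[OF this] zero_le_square[of "v x"]]
    show ?thesis by (simp only: mult.assoc)
  qed
  ultimately have "weight e * v e * v e = 0" using assms(2,3) by (simp add: sum_nonneg_eq_0_iff)
  then show ?thesis using weight_pos[of e] assms(1,3) by auto
qed

lemma PI_nonempty: "PI T \<noteq> {}"
  using domain_nonempty pcells_cover closure_subset[of \<Omega>] by blast

text \<open>Tested against itself by \<open>perp_grad_adjoint\<close>, the skew gradient has zero
  weighted norm.\<close>

lemma curl_perp_grad_zero:
  assumes "\<And>\<nu>. \<nu> \<in> DI T \<Longrightarrow> curl_h T (perp_grad_h \<Omega> T \<psi>) \<nu> = 0" "e \<in> EI T"
  shows "perp_grad_h \<Omega> T \<psi> e = 0"
proof (rule weighted_square_zero[OF subset_refl _ assms(2)])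
  show "(\<Sum>e\<in>EI T. weight e * perp_grad_h \<Omega> T \<psi> e * perp_grad_h \<Omega> T \<psi> e) = 0"
    unfolding perp_grad_adjoint using assms(1) by simp
qed

text \<open>By Euler's relation, this is a square linear system in \<open>\<phi>\<close> and \<open>\<psi>\<close> once the value
  of \<open>\<phi>\<close> on one cell is fixed to be zero.\<close>

lemma discrete_Helmholtz: "\<exists>\<phi> \<psi>. \<forall>e\<in>EI T. grad_h T \<phi> e + perp_grad_h \<Omega> T \<psi> e = w e"
proof -
  obtain i0 where i0: "i0 \<in> PI T" using PI_nonempty by blast
  \<comment> \<open>The unknowns are the cell values except at \<open>i0\<close> and the dual cell
    values; \<open>\<Phi>\<close> restores the zero at \<open>i0\<close>.\<close>
  define I where "I = (PI T - {i0}) <+> DI T"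
  define a where "a e k = (case k of
      Inl i \<Rightarrow> if i \<in> CE T e then - (nsgn T e i / dlen T e) else 0
    | Inr \<nu> \<Rightarrow> if \<nu> \<in> VE T e then tsgn T e \<nu> / plen \<Omega> T e else 0)" for e and k :: "nat + nat"
  define \<Phi> where "\<Phi> x i = (if i = i0 then 0 else x (Inl i))" for x :: "nat + nat \<Rightarrow> real" and i
  define \<Psi> where "\<Psi> x \<nu> = x (Inr \<nu>)" for x :: "nat + nat \<Rightarrow> real" and \<nu>
  have op: "(\<Sum>k\<in>I. a e k * x k) = grad_h T (\<Phi> x) e + perp_grad_h \<Omega> T (\<Psi> x) e" for e x
  proof -
    have "grad_h T (\<Phi> x) e = (\<Sum>i\<in>CE T e. - (nsgn T e i / dlen T e) * \<Phi> x i)"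
      by (simp add: grad_h_def sum_distrib_left mult_ac)
    also have "\<dots> = (\<Sum>i\<in>PI T. a e (Inl i) * \<Phi> x i)"
      using CE_subset[of e] by (intro sum.mono_neutral_cong_left) (auto simp: a_def)
    also have "\<dots> = (\<Sum>i\<in>PI T - {i0}. a e (Inl i) * x (Inl i))"
      by (intro sum.mono_neutral_cong_right) (auto simp: \<Phi>_def)
    finally have 1: "grad_h T (\<Phi> x) e = (\<Sum>i\<in>PI T - {i0}. a e (Inl i) * x (Inl i))" .
    have "perp_grad_h \<Omega> T (\<Psi> x) e = (\<Sum>\<nu>\<in>VE T e. tsgn T e \<nu> / plen \<Omega> T e * \<Psi> x \<nu>)"
      by (simp add: perp_grad_h_def sum_distrib_left mult_ac)
    also have "\<dots> = (\<Sum>\<nu>\<in>DI T. a e (Inr \<nu>) * x (Inr \<nu>))"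
      using VE_subset[of e] by (intro sum.mono_neutral_cong_left) (auto simp: a_def \<Psi>_def)
    finally show ?thesis unfolding 1 I_def by (simp add: sum.Plus)
  qed
  have "finite I" by (simp add: I_def)
  have "card I = Nc T + Ncb T - 1 + Nv T"
    unfolding I_def using i0 by (simp add: card_Plus)
  moreover have "1 \<le> Nc T + Ncb T" using i0 by auto
  ultimately have card: "card (EI T) \<le> card I" using Euler by simp
  \<comment> \<open>The curl annihilates the gradient part, so the skew part is curl-free and
    vanishes; then \<open>\<Psi> x\<close> is zero and \<open>\<Phi> x\<close> is constant, with
    value 0 at \<open>i0\<close>.\<close>
  have inj: "x k = 0"
    if x: "\<forall>e\<in>EI T. (\<Sum>k\<in>I. a e k * x k) = 0" and k: "k \<in> I" for x k
  proof -
    have sum0: "grad_h T (\<Phi> x) e + perp_grad_h \<Omega> T (\<Psi> x) e = 0" if "e \<in> EI T" for e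
      using x that op by simp
    have "curl_h T (perp_grad_h \<Omega> T (\<Psi> x)) \<nu> = 0" if "\<nu> \<in> DI T" for \<nu>
    proof -
      have "curl_h T (perp_grad_h \<Omega> T (\<Psi> x)) \<nu> + curl_h T (grad_h T (\<Phi> x)) \<nu> = curl_h T (\<lambda>_. 0) \<nu>"
        unfolding curl_h_add[symmetric] using sum0 by (intro curl_h_cong) (simp add: add.commute)
      then show ?thesis using curl_grad[OF that] by (simp add: curl_h_def)
    qed
    then have perp0: "perp_grad_h \<Omega> T (\<Psi> x) e = 0" if "e \<in> EI T" for e
      using curl_perp_grad_zero that by blast
    then have "\<Psi> x \<nu> = 0" if "\<nu> \<in> DI T" for \<nu> using perp_grad_zero that by blast
    moreover have "grad_h T (\<Phi> x) e = 0" if "e \<in> EI T" for e using sum0[OF that] perp0[OF that] by simp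
    then have const: "\<Phi> x i = \<Phi> x i0" if "i \<in> PI T" for i using grad_zero_const i0 that by blast
    have "x (Inl i) = 0" if "i \<in> PI T - {i0}" for i
      using const[of i] that by (simp add: \<Phi>_def)
    ultimately show ?thesis using k unfolding I_def \<Psi>_def by blast
  qed
  obtain x where "\<forall>e\<in>EI T. (\<Sum>k\<in>I. a e k * x k) = w e"
    using square_system_solvable[of "EI T" I a w, OF _ \<open>finite I\<close> card] inj by auto
  then show ?thesis unfolding op by blast
qed

text \<open>The Helmholtz decomposition leaves only a gradient, and elements of \<open>V_h\<close>
  are orthogonal to gradients; so \<open>v\<close> is orthogonal to itself.\<close>

lemma V_h_curl_zero:
  assumes v: "v \<in> V_h \<Omega> T" and curl: "\<And>\<nu>. \<nu> \<in> DI T \<Longrightarrow> curl_h T v \<nu> = 0"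
  shows "v = (\<lambda>_. 0)"
proof -
  obtain \<phi> \<psi> where \<phi>\<psi>: "\<And>e. e \<in> EI T \<Longrightarrow> grad_h T \<phi> e + perp_grad_h \<Omega> T \<psi> e = v e"
    using discrete_Helmholtz[of v] by blast
  have "curl_h T (perp_grad_h \<Omega> T \<psi>) \<nu> = 0" if "\<nu> \<in> DI T" for \<nu>
  proof -
    have "curl_h T (grad_h T \<phi>) \<nu> + curl_h T (perp_grad_h \<Omega> T \<psi>) \<nu> = curl_h T v \<nu>"
      unfolding curl_h_add[symmetric] using \<phi>\<psi> by (rule curl_h_cong)
    then show ?thesis using curl[OF that] curl_grad[OF that] by simp
  qed
  then have eq: "v e = grad_h T \<phi> e" if "e \<in> EI T" for e
    using curl_perp_grad_zero \<phi>\<psi>[OF that] that by simp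
  have "(\<Sum>e\<in>{1..Ne T}. weight e * v e * v e) = (\<Sum>e\<in>{1..Ne T}. weight e * v e * grad_h T \<phi> e)"
    using eq by (intro sum.cong) auto
  then have "(\<Sum>e\<in>{1..Ne T}. weight e * v e * v e) = 0" using V_h_grad[OF v] by simp
  then have "v e = 0" if "e \<in> {1..Ne T}" for e
    using weighted_square_zero[of "{1..Ne T}" v e] that by auto
  then show ?thesis using v by (auto simp: V_h_def fun_eq_iff)
qed

text \<open>Projection of \<open>b\<close> over interior edges onto the gradients of cell
  indicators. By adjointness, orthogonality to the gradient of the indicator of cell
  \<open>i\<close> is the vanishing of the divergence there, so the residual, extended by zero, lies
  in \<open>V_h\<close>.\<close>

lemma interior_decomposition:
  "\<exists>p. \<exists>v\<in>V_h \<Omega> T. \<forall>e\<in>{1..Ne T}. b e = grad_h T p e + v e"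
proof -
  let ?E = "{1..Ne T}"
  define a where "a i e = grad_h T (\<lambda>k. if k = i then 1 else 0) e" for i e
  obtain p where p: "\<forall>i\<in>PI T. (\<Sum>e\<in>?E. weight e * a i e * (b e - (\<Sum>k\<in>PI T. p k * a k e))) = 0"
    using weighted_projection[of "PI T" ?E weight a b] weight_pos by auto
  define q where "q i = (\<Sum>k\<in>PI T. p k * (if i = k then 1 else 0))" for i
  have q: "(\<Sum>k\<in>PI T. p k * a k e) = grad_h T q e" for e
    unfolding a_def q_def by (rule grad_h_sum[symmetric])
  define v where "v e = (if e \<in> ?E then b e - grad_h T q e else 0)" for e
  have "div_h \<Omega> T v i = 0" if i: "i \<in> PI T" for i
  proof -
    have "0 = (\<Sum>e\<in>?E. weight e * a i e * (b e - grad_h T q e))" using p[unfolded q] i by simp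
    also have "\<dots> = (\<Sum>e\<in>?E. weight e * a i e * v e)" by (intro sum.cong) (auto simp: v_def)
    also have "\<dots> = (\<Sum>e\<in>EI T. weight e * v e * a i e)"
      by (intro sum.mono_neutral_cong_left) (auto simp: v_def)
    also have "\<dots> = - (\<Sum>k\<in>PI T. (if k = i then 1 else 0) * (parea \<Omega> T k * div_h \<Omega> T v k))"
      unfolding a_def by (rule grad_adjoint)
    also have "\<dots> = - (\<Sum>k\<in>PI T. if k = i then parea \<Omega> T k * div_h \<Omega> T v k else 0)"
      by (intro arg_cong[where f = uminus] sum.cong) auto
    also have "\<dots> = - (parea \<Omega> T i * div_h \<Omega> T v i)" using i by simp
    finally show ?thesis using parea_pos[OF i] by simp
  qed
  then have "v \<in> V_h \<Omega> T" by (auto simp: V_h_def v_def)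
  then show ?thesis by (intro exI[of _ q] bexI[of _ v]) (auto simp: v_def)
qed

text \<open>The residual \<open>r\<close> of projecting \<open>- \<psi>\<close> onto the curls of
  \<open>V_h\<close> is orthogonal to these curls, so its skew gradient is orthogonal to
  \<open>V_h\<close>. By \<open>interior_decomposition\<close> that skew gradient is a gradient on
  interior edges, which enters the pressure.\<close>

lemma stokes_exists:
  "\<exists>u\<in>V_h \<Omega> T. \<exists>p. stokes_h \<Omega> T (\<lambda>e. perp_grad_h \<Omega> T \<psi> e + grad_h T \<phi> e) u p"
proof -
  let ?E = "{1..Ne T}"
  \<comment> \<open>The \<open>V_h\<close> parts of the unit vectors form a finite spanning set,
    which makes the projection onto the curls of \<open>V_h\<close> a finite system.\<close>
  have "\<forall>k. \<exists>p v. v \<in> V_h \<Omega> T \<and> (\<forall>e\<in>?E. (if e = k then 1 else 0) = grad_h T p e + v e)"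
  proof
    fix k show "\<exists>p v. v \<in> V_h \<Omega> T \<and> (\<forall>e\<in>?E. (if e = k then 1 else 0) = grad_h T p e + v e)"
      using interior_decomposition[of "\<lambda>e. if e = k then 1 else 0"] by blast
  qed
  then obtain P B where B: "\<And>k. B k \<in> V_h \<Omega> T"
      and PB: "\<And>k e. e \<in> ?E \<Longrightarrow> (if e = k then 1 else 0) = grad_h T (P k) e + B k e"
    by metis
  \<comment> \<open>The difference \<open>r\<close> between \<open>v\<close> and its expansion is at
    once in \<open>V_h\<close> and a gradient on interior edges, hence orthogonal to itself.\<close>
  have span: "v e = (\<Sum>k\<in>?E. v k * B k e)" if v: "v \<in> V_h \<Omega> T" and e: "e \<in> ?E" for v e
  proof -
    define s where "s e = (\<Sum>k\<in>?E. v k * B k e)" for e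
    define r where "r e = v e - s e" for e
    have r: "r \<in> V_h \<Omega> T" unfolding r_def s_def using v B by (intro V_h_diff V_h_sum)
    have "r e = grad_h T (\<lambda>i. \<Sum>k\<in>?E. v k * P k i) e" if e: "e \<in> ?E" for e
    proof -
      have "v e = (\<Sum>k\<in>?E. if k = e then v k else 0)" using e by simp
      also have "\<dots> = (\<Sum>k\<in>?E. v k * (if e = k then 1 else 0))" by (intro sum.cong) auto
      also have "\<dots> = (\<Sum>k\<in>?E. v k * (grad_h T (P k) e + B k e))" using PB[OF e] by simp
      finally show ?thesis
        by (simp add: r_def s_def grad_h_sum algebra_simps sum.distrib)
    qed
    then have "(\<Sum>e\<in>?E. weight e * r e * r e)
        = (\<Sum>e\<in>?E. weight e * r e * grad_h T (\<lambda>i. \<Sum>k\<in>?E. v k * P k i) e)"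
      by (intro sum.cong) auto
    then have "(\<Sum>e\<in>?E. weight e * r e * r e) = 0" using V_h_grad[OF r] by simp
    then have "r e = 0" using e by (intro weighted_square_zero[of ?E r e]) auto
    then show ?thesis by (simp add: r_def s_def)
  qed
  obtain c where c: "\<forall>k\<in>?E. (\<Sum>\<nu>\<in>DI T. darea T \<nu> * curl_h T (B k) \<nu> *
      (- \<psi> \<nu> - (\<Sum>l\<in>?E. c l * curl_h T (B l) \<nu>))) = 0"
    using weighted_projection[of ?E "DI T" "darea T" "\<lambda>k. curl_h T (B k)" "\<lambda>\<nu>. - \<psi> \<nu>"] darea_pos by auto
  define u where "u e = (\<Sum>k\<in>?E. c k * B k e)" for e
  have u: "u \<in> V_h \<Omega> T" unfolding u_def using B by (intro V_h_sum)
  define r where "r \<nu> = - \<psi> \<nu> - curl_h T u \<nu>" for \<nu>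
  have rB: "(\<Sum>\<nu>\<in>DI T. darea T \<nu> * r \<nu> * curl_h T (B k) \<nu>) = 0" if "k \<in> ?E" for k
  proof -
    have "curl_h T u \<nu> = (\<Sum>l\<in>?E. c l * curl_h T (B l) \<nu>)" for \<nu>
      unfolding u_def[abs_def] by (rule curl_h_sum)
    then show ?thesis using c that by (simp add: r_def mult_ac)
  qed
  have rv: "(\<Sum>\<nu>\<in>DI T. darea T \<nu> * r \<nu> * curl_h T v \<nu>) = 0" if v: "v \<in> V_h \<Omega> T" for v
  proof -
    have "curl_h T v \<nu> = (\<Sum>k\<in>?E. v k * curl_h T (B k) \<nu>)" for \<nu>
    proof -
      have "curl_h T v \<nu> = curl_h T (\<lambda>e. \<Sum>k\<in>?E. v k * B k e) \<nu>"
      proof (rule curl_h_cong)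
        fix e assume "e \<in> EI T"
        then show "v e = (\<Sum>k\<in>?E. v k * B k e)"
        proof (cases "e \<in> ?E")
          case False
          then show ?thesis using v B by (auto simp: V_h_def)
        qed (rule span[OF v])
      qed
      then show ?thesis by (simp only: curl_h_sum)
    qed
    then have "(\<Sum>\<nu>\<in>DI T. darea T \<nu> * r \<nu> * curl_h T v \<nu>)
        = (\<Sum>\<nu>\<in>DI T. \<Sum>k\<in>?E. v k * (darea T \<nu> * r \<nu> * curl_h T (B k) \<nu>))"
      by (simp add: sum_distrib_left mult_ac)
    also have "\<dots> = (\<Sum>k\<in>?E. v k * (\<Sum>\<nu>\<in>DI T. darea T \<nu> * r \<nu> * curl_h T (B k) \<nu>))"
      unfolding sum_distrib_left by (rule sum.swap)
    finally show ?thesis using rB by simp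
  qed
  obtain p v where v: "v \<in> V_h \<Omega> T"
      and pv: "\<And>e. e \<in> ?E \<Longrightarrow> perp_grad_h \<Omega> T r e = grad_h T p e + v e"
    using interior_decomposition[of "perp_grad_h \<Omega> T r"] by blast
  have "(\<Sum>e\<in>?E. weight e * v e * v e)
      = (\<Sum>e\<in>?E. weight e * v e * perp_grad_h \<Omega> T r e) - (\<Sum>e\<in>?E. weight e * v e * grad_h T p e)"
    unfolding sum_subtractf[symmetric] using pv by (intro sum.cong) (auto simp: algebra_simps)
  also have "\<dots> = 0" using V_h_grad[OF v] V_h_perp_grad[OF v] rv[OF v] by simp
  finally have "v e = 0" if "e \<in> ?E" for e
    using that by (intro weighted_square_zero[of ?E v e]) auto
  then have pg: "perp_grad_h \<Omega> T r e = grad_h T p e" if "e \<in> ?E" for e using pv that by simp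
  \<comment> \<open>Since \<open>r\<close> is \<open>- \<psi>\<close> minus the curl of
    \<open>u\<close>, the equation for \<open>p\<close> turns into the scheme with
    \<open>\<phi> - p\<close> as pressure.\<close>
  have "stokes_h \<Omega> T (\<lambda>e. perp_grad_h \<Omega> T \<psi> e + grad_h T \<phi> e) u (\<lambda>i. \<phi> i - p i)"
    unfolding stokes_h_def
  proof
    fix e assume "e \<in> ?E"
    then have "- perp_grad_h \<Omega> T \<psi> e - perp_grad_h \<Omega> T (curl_h T u) e = grad_h T p e"
      using pg by (simp add: r_def[abs_def] perp_grad_h_diff perp_grad_h_uminus)
    then show "- perp_grad_h \<Omega> T (curl_h T u) e + grad_h T (\<lambda>i. \<phi> i - p i) e
        = perp_grad_h \<Omega> T \<psi> e + grad_h T \<phi> e"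
      by (simp add: grad_h_diff)
  qed
  with u show ?thesis by blast
qed

lemma stokes_energy:
  assumes u: "u \<in> V_h \<Omega> T" and s: "stokes_h \<Omega> T (\<lambda>e. perp_grad_h \<Omega> T \<psi> e + grad_h T \<phi> e) u p"
  shows "(\<Sum>\<nu>\<in>DI T. darea T \<nu> * (curl_h T u \<nu>)\<^sup>2) = - (\<Sum>\<nu>\<in>DI T. darea T \<nu> * \<psi> \<nu> * curl_h T u \<nu>)"
proof -
  let ?E = "{1..Ne T}"
  have "(\<Sum>e\<in>?E. weight e * u e * perp_grad_h \<Omega> T \<psi> e)
      = - (\<Sum>e\<in>?E. weight e * u e * perp_grad_h \<Omega> T (curl_h T u) e)
        + (\<Sum>e\<in>?E. weight e * u e * grad_h T p e) - (\<Sum>e\<in>?E. weight e * u e * grad_h T \<phi> e)"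
    unfolding sum_subtractf[symmetric] sum.distrib[symmetric] sum_negf[symmetric]
  proof (rule sum.cong[OF refl])
    fix e assume "e \<in> ?E"
    then have "perp_grad_h \<Omega> T \<psi> e
        = - perp_grad_h \<Omega> T (curl_h T u) e + grad_h T p e - grad_h T \<phi> e"
      using s by (simp add: stokes_h_def)
    then show "weight e * u e * perp_grad_h \<Omega> T \<psi> e = - (weight e * u e * perp_grad_h \<Omega> T (curl_h T u) e)
        + weight e * u e * grad_h T p e - weight e * u e * grad_h T \<phi> e"
      by (simp only: distrib_left right_diff_distrib mult_minus_right)
  qed
  then show ?thesis
    using V_h_grad[OF u] V_h_perp_grad[OF u] by (simp add: power2_eq_square mult.assoc)
qed

text \<open>The difference solves the problem with zero forcing, so the energy identity removes its
  curl and \<open>V_h_curl_zero\<close> the field itself.\<close>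

lemma stokes_unique:
  assumes "u \<in> V_h \<Omega> T" "stokes_h \<Omega> T F u p" "v \<in> V_h \<Omega> T" "stokes_h \<Omega> T F v q"
  shows "u = v"
proof -
  define w where "w e = u e - v e" for e
  have w: "w \<in> V_h \<Omega> T" unfolding w_def using assms by (intro V_h_diff)
  have "stokes_h \<Omega> T (\<lambda>e. perp_grad_h \<Omega> T (\<lambda>_. 0) e + grad_h T (\<lambda>_. 0) e) w (\<lambda>i. p i - q i)"
    unfolding stokes_h_def
  proof
    fix e assume "e \<in> {1..Ne T}"
    then have "- perp_grad_h \<Omega> T (curl_h T u) e + grad_h T p e = F e"
      "- perp_grad_h \<Omega> T (curl_h T v) e + grad_h T q e = F e"
      using assms(2,4) by (simp_all add: stokes_h_def)
    moreover have "curl_h T w = (\<lambda>\<nu>. curl_h T u \<nu> - curl_h T v \<nu>)"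
      by (simp add: w_def[abs_def] curl_h_diff fun_eq_iff)
    moreover have "perp_grad_h \<Omega> T (\<lambda>_. 0) e = 0" "grad_h T (\<lambda>_. 0) e = 0"
      by (simp_all add: perp_grad_h_def grad_h_def)
    ultimately show "- perp_grad_h \<Omega> T (curl_h T w) e + grad_h T (\<lambda>i. p i - q i) e
        = perp_grad_h \<Omega> T (\<lambda>_. 0) e + grad_h T (\<lambda>_. 0) e"
      by (simp add: perp_grad_h_diff grad_h_diff)
  qed
  from stokes_energy[OF w this] have "(\<Sum>\<nu>\<in>DI T. darea T \<nu> * (curl_h T w \<nu>)\<^sup>2) = 0" by simp
  moreover have "0 \<le> darea T \<nu> * (curl_h T w \<nu>)\<^sup>2" for \<nu> by (simp add: darea_def)
  ultimately have "darea T \<nu> * (curl_h T w \<nu>)\<^sup>2 = 0" if "\<nu> \<in> DI T" for \<nu>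
    using that by (simp add: sum_nonneg_eq_0_iff)
  then have "curl_h T w \<nu> = 0" if "\<nu> \<in> DI T" for \<nu> using darea_pos[OF that] that by force
  then have "w = (\<lambda>_. 0)" using V_h_curl_zero[OF w] by blast
  then show ?thesis by (simp add: w_def fun_eq_iff)
qed

text \<open>With \<open>u\<close> fixed, the gradient of \<open>q - p\<close> is known to vanish on
  interior edges alone, whereas \<open>grad_zero_const\<close> asks for all edges. Chains of
  interior edges from \<open>interior_connected\<close> take its place.\<close>

lemma stokes_pressure:
  assumes conn: "interior_connected T" and p: "stokes_h \<Omega> T F u p"
  shows "stokes_h \<Omega> T F u q \<longleftrightarrow> (\<exists>c. \<forall>i\<in>PI T. q i = p i + c)"
proof -
  have "stokes_h \<Omega> T F u q \<longleftrightarrow> (\<forall>e\<in>{1..Ne T}. grad_h T (\<lambda>i. q i - p i) e = 0)"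
    unfolding stokes_h_def
  proof (rule ball_cong[OF refl])
    fix e assume "e \<in> {1..Ne T}"
    then have "- perp_grad_h \<Omega> T (curl_h T u) e + grad_h T p e = F e"
      using p unfolding stokes_h_def by blast
    then show "(- perp_grad_h \<Omega> T (curl_h T u) e + grad_h T q e = F e)
        \<longleftrightarrow> grad_h T (\<lambda>i. q i - p i) e = 0"
      unfolding grad_h_diff by linarith
  qed
  also have "\<dots> \<longleftrightarrow> (\<exists>c. \<forall>i\<in>PI T. q i = p i + c)"
  proof
    assume zero: "\<forall>e\<in>{1..Ne T}. grad_h T (\<lambda>i. q i - p i) e = 0"
    let ?R = "{(i, j). \<exists>e\<in>{1..Ne T}. CE T e = {i, j}}"
    have edge: "q i - p i = q j - p j" if "(i, j) \<in> ?R" for i j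
    proof (cases "i = j")
      case False
      from that have "\<exists>e\<in>{1..Ne T}. CE T e = {i, j}" by simp
      then obtain e where "e \<in> {1..Ne T}" "CE T e = {i, j}" by blast
      then show ?thesis
        using grad_zero_pair[of e i j "\<lambda>i. q i - p i"] zero False by simp
    qed simp
    have path: "q i - p i = q j - p j" if "(i, j) \<in> ?R\<^sup>*" for i j
      using that
    proof (induction rule: rtrancl_induct)
      case (step k l)
      then show ?case using edge[OF step.hyps(2)] by simp
    qed simp
    obtain i0 where i0: "i0 \<in> PI T" using PI_nonempty by blast
    have "q i = p i + (q i0 - p i0)" if "i \<in> PI T" for i
    proof -
      have "(i, i0) \<in> ?R\<^sup>*" using conn i0 that unfolding interior_connected_def by blast
      then show ?thesis using path[of i i0] by simp
    qed
    then show "\<exists>c. \<forall>i\<in>PI T. q i = p i + c" by blast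
  next
    assume "\<exists>c. \<forall>i\<in>PI T. q i = p i + c"
    then obtain c where c: "\<And>i. i \<in> PI T \<Longrightarrow> q i = p i + c" by blast
    show "\<forall>e\<in>{1..Ne T}. grad_h T (\<lambda>i. q i - p i) e = 0"
    proof
      fix e assume "e \<in> {1..Ne T}"
      then have e: "e \<in> EI T" by simp
      obtain i j where ij: "i \<noteq> j" "CE T e = {i, j}" using primal_pair e by blast
      have "{i, j} \<subseteq> PI T" unfolding ij(2)[symmetric] by (rule CE_subset)
      then show "grad_h T (\<lambda>i. q i - p i) e = 0"
        unfolding grad_zero_pair[OF e ij(2,1)] using c by simp
    qed
  qed
  finally show ?thesis .
qed

section \<open>The energy bound\<close>

text \<open>Closed dual cells overlap only along edges, a null set. This lets integrals over
  \<open>\<Omega>\<close> be computed cell by cell.\<close>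

lemma AE_unique_dcell:
  "AE x in lebesgue_on \<Omega>. \<exists>\<nu>\<in>DI T. \<forall>\<mu>\<in>DI T. x \<in> dcell T \<mu> \<longleftrightarrow> \<mu> = \<nu>"
proof -
  define N where "N = (\<Union>\<nu>\<in>DI T. \<Union>(polygon_edges (dverts T \<nu>)))"
  have "negligible N"
    unfolding N_def by (intro negligible_Union) (auto simp: negligible_polygon_boundary)
  then have "AE x in lebesgue. x \<notin> N"
    by (simp add: negligible_iff_null_sets AE_not_in)
  then have "AE x in lebesgue. x \<in> \<Omega> \<longrightarrow> (\<exists>\<nu>\<in>DI T. \<forall>\<mu>\<in>DI T. x \<in> dcell T \<mu> \<longleftrightarrow> \<mu> = \<nu>)"
  proof eventually_elim
    case (elim x)
    show ?case
    proof
      assume "x \<in> \<Omega>"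
      then obtain \<nu> where \<nu>: "\<nu> \<in> DI T" "x \<in> dcell T \<nu>"
        using dcells_cover closure_subset[of \<Omega>] by blast
      have int: "x \<in> interior (dcell T \<mu>)" if "\<mu> \<in> DI T" "x \<in> dcell T \<mu>" for \<mu>
        unfolding interior_dcell[OF that(1)]
        using that elim by (auto simp: N_def dcell_def polygon_def)
      have "\<mu> = \<nu>" if "\<mu> \<in> DI T" "x \<in> dcell T \<mu>" for \<mu>
        using int[OF that] int[OF \<nu>] dcells_disjoint that(1) \<nu>(1) by blast
      then show "\<exists>\<nu>\<in>DI T. \<forall>\<mu>\<in>DI T. x \<in> dcell T \<mu> \<longleftrightarrow> \<mu> = \<nu>" using \<nu> by blast
    qed
  qed
  then show ?thesis
    using open_domain by (subst AE_restrict_space_iff) (auto simp: borel_open)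
qed

lemma sum_unique_dcell:
  assumes "\<nu> \<in> DI T" "\<forall>\<mu>\<in>DI T. x \<in> dcell T \<mu> \<longleftrightarrow> \<mu> = \<nu>"
  shows "(\<Sum>\<mu>\<in>DI T. c \<mu> * indicat_real (dcell T \<mu>) x) = c \<nu>"
proof -
  have "(\<Sum>\<mu>\<in>DI T. c \<mu> * indicat_real (dcell T \<mu>) x) = (\<Sum>\<mu>\<in>DI T. if \<mu> = \<nu> then c \<mu> else 0)"
    using assms(2) by (intro sum.cong) (auto simp: indicator_def)
  then show ?thesis using assms(1) by simp
qed

lemma sets_domain: "\<Omega> \<in> sets lebesgue"
  using open_domain by (simp add: borel_open)

lemma measure_dcell_part:
  assumes "\<nu> \<in> DI T"
  shows "measure lebesgue (dcell T \<nu> \<inter> \<Omega>) = darea T \<nu>"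
proof -
  have "(dcell T \<nu> - dcell T \<nu> \<inter> \<Omega>) \<union> (dcell T \<nu> \<inter> \<Omega> - dcell T \<nu>) \<subseteq> frontier \<Omega>"
    using dcell_subset[OF assms] open_domain by (auto simp: frontier_def interior_open)
  then have "negligible ((dcell T \<nu> - dcell T \<nu> \<inter> \<Omega>) \<union> (dcell T \<nu> \<inter> \<Omega> - dcell T \<nu>))"
    using negligible_frontier_domain negligible_subset by blast
  then show ?thesis
    unfolding darea_def by (rule measure_negligible_symdiff[OF lmeasurable_dcell])
qed

lemma indicator_dcell_integral:
  assumes "\<nu> \<in> DI T"
  shows "integrable (lebesgue_on \<Omega>) (indicat_real (dcell T \<nu>))"
    and "(LINT x|lebesgue_on \<Omega>. indicat_real (dcell T \<nu>) x) = darea T \<nu>"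
proof -
  have ind: "(\<lambda>x. indicat_real \<Omega> x * indicat_real (dcell T \<nu>) x) = indicat_real (dcell T \<nu> \<inter> \<Omega>)"
    by (auto simp: indicator_def fun_eq_iff)
  have "dcell T \<nu> \<inter> \<Omega> \<in> lmeasurable"
    using lmeasurable_dcell sets_domain by (rule fmeasurable_Int_fmeasurable)
  then have "integrable lebesgue (indicat_real (dcell T \<nu> \<inter> \<Omega>))"
    by (simp only: lmeasurable_iff_integrable)
  then show "integrable (lebesgue_on \<Omega>) (indicat_real (dcell T \<nu>))"
    using sets_domain by (simp add: integrable_restrict_space ind)
  show "(LINT x|lebesgue_on \<Omega>. indicat_real (dcell T \<nu>) x) = darea T \<nu>"
    using sets_domain by (simp add: integral_restrict_space ind measure_restrict_space measure_dcell_part[OF assms])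
qed

lemma norm_1h_square: "(norm_1h \<Omega> T u)\<^sup>2 = (\<Sum>\<nu>\<in>DI T. darea T \<nu> * (curl_h T u \<nu>)\<^sup>2)"
proof -
  define c where "c = curl_h T u"
  have ind: "indicat_real (dcell T \<nu>) \<in> borel_measurable (lebesgue_on \<Omega>)" if "\<nu> \<in> DI T" for \<nu>
    using indicator_dcell_integral(1)[OF that] by (rule borel_measurable_integrable)
  have dual: "dual_fun T c \<in> borel_measurable (lebesgue_on \<Omega>)"
    unfolding dual_fun_def[abs_def] using ind by (intro borel_measurable_sum borel_measurable_times) auto
  have "(LINT x|lebesgue_on \<Omega>. (norm (dual_fun T c x))\<^sup>2)
      = (LINT x|lebesgue_on \<Omega>. (\<Sum>\<nu>\<in>DI T. (c \<nu>)\<^sup>2 * indicat_real (dcell T \<nu>) x))"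
  \<comment> \<open>On shared edges the coefficients in \<open>dual_fun\<close> add up, so squaring
    commutes with the sum only almost everywhere.\<close>
  proof (rule integral_cong_AE)
    show "(\<lambda>x. (norm (dual_fun T c x))\<^sup>2) \<in> borel_measurable (lebesgue_on \<Omega>)"
      using dual by measurable
    show "(\<lambda>x. \<Sum>\<nu>\<in>DI T. (c \<nu>)\<^sup>2 * indicat_real (dcell T \<nu>) x) \<in> borel_measurable (lebesgue_on \<Omega>)"
      using ind by (intro borel_measurable_sum borel_measurable_times) auto
    show "AE x in lebesgue_on \<Omega>. (norm (dual_fun T c x))\<^sup>2
        = (\<Sum>\<nu>\<in>DI T. (c \<nu>)\<^sup>2 * indicat_real (dcell T \<nu>) x)"
      using AE_unique_dcell
    proof eventually_elim
      case (elim x)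
      then obtain \<nu> where \<nu>: "\<nu> \<in> DI T" "\<forall>\<mu>\<in>DI T. x \<in> dcell T \<mu> \<longleftrightarrow> \<mu> = \<nu>" by blast
      show ?case unfolding dual_fun_def sum_unique_dcell[OF \<nu>] by simp
    qed
  qed
  also have "\<dots> = (\<Sum>\<nu>\<in>DI T. LINT x|lebesgue_on \<Omega>. (c \<nu>)\<^sup>2 * indicat_real (dcell T \<nu>) x)"
    by (intro Bochner_Integration.integral_sum integrable_mult_right indicator_dcell_integral(1))
  also have "\<dots> = (\<Sum>\<nu>\<in>DI T. darea T \<nu> * (c \<nu>)\<^sup>2)"
    using indicator_dcell_integral(2) by (intro sum.cong) (auto simp: mult.commute)
  finally have "(LINT x|lebesgue_on \<Omega>. (norm (dual_fun T c x))\<^sup>2) = (\<Sum>\<nu>\<in>DI T. darea T \<nu> * (c \<nu>)\<^sup>2)" .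
  then show ?thesis
    unfolding norm_1h_def L2norm_def c_def by (simp add: sum_nonneg darea_def)
qed

text \<open>Nonnegativity of the variance on the cell: the integral of
  \<open>(\<psi> x - a)\<^sup>2\<close> is that of \<open>(\<psi> x)\<^sup>2\<close> minus
  \<open>darea T \<nu> * a\<^sup>2\<close>.\<close>

lemma davg_square_bound:
  assumes \<nu>: "\<nu> \<in> DI T" and \<psi>: "\<psi> \<in> L2 \<Omega>"
  shows "darea T \<nu> * (davg \<Omega> T \<psi> \<nu>)\<^sup>2 \<le> (LINT x|lebesgue_on \<Omega>. indicat_real (dcell T \<nu>) x * (\<psi> x)\<^sup>2)"
    and "integrable (lebesgue_on \<Omega>) (\<lambda>x. indicat_real (dcell T \<nu>) x * (\<psi> x)\<^sup>2)"
proof -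
  let ?D = "dcell T \<nu> \<inter> \<Omega>"
  let ?M = "lebesgue_on ?D"
  define a where "a = davg \<Omega> T \<psi> \<nu>"
  have D: "?D \<in> lmeasurable"
    using lmeasurable_dcell sets_domain by (rule fmeasurable_Int_fmeasurable)
  then have Ds: "?D \<in> sets lebesgue" by (rule fmeasurableD)
  interpret finite_measure ?M using D by (rule finite_measure_lebesgue_on)
  have sq: "integrable (lebesgue_on \<Omega>) (\<lambda>x. (\<psi> x)\<^sup>2)" and
    mb: "\<psi> \<in> borel_measurable (lebesgue_on \<Omega>)"
    using \<psi> by (auto simp: L2_def)
  have "\<psi> \<in> borel_measurable ?M" using mb by (rule measurable_restrict_mono) auto
  show "integrable (lebesgue_on \<Omega>) (\<lambda>x. indicat_real (dcell T \<nu>) x * (\<psi> x)\<^sup>2)"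
  proof (rule Bochner_Integration.integrable_bound[OF sq])
    show "(\<lambda>x. indicat_real (dcell T \<nu>) x * (\<psi> x)\<^sup>2) \<in> borel_measurable (lebesgue_on \<Omega>)"
      using borel_measurable_integrable[OF indicator_dcell_integral(1)[OF \<nu>]]
        borel_measurable_integrable[OF sq] by (rule borel_measurable_times)
  qed (auto simp: indicator_def)
  moreover have ind: "(\<lambda>x. indicat_real ?D x * (\<psi> x)\<^sup>2)
      = (\<lambda>x. indicat_real \<Omega> x * (indicat_real (dcell T \<nu>) x * (\<psi> x)\<^sup>2))"
    by (auto simp: indicator_def fun_eq_iff)
  ultimately have sqM: "integrable ?M (\<lambda>x. (\<psi> x)\<^sup>2)"
    using Ds sets_domain by (simp add: integrable_restrict_space ind)
  have int_sq: "(LINT x|?M. (\<psi> x)\<^sup>2) = (LINT x|lebesgue_on \<Omega>. indicat_real (dcell T \<nu>) x * (\<psi> x)\<^sup>2)"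
    using Ds sets_domain by (simp add: integral_restrict_space ind)
  \<comment> \<open>Square integrability gives integrability on a cell of finite measure, with
    \<open>1 + (\<psi> x)\<^sup>2\<close> as dominating function.\<close>
  have abs: "\<bar>t\<bar> \<le> 1 + t\<^sup>2" for t :: real
  proof -
    have "0 \<le> (\<bar>t\<bar> - 1)\<^sup>2 + \<bar>t\<bar>" by simp
    also have "\<dots> = 1 + t\<^sup>2 - \<bar>t\<bar>" by (simp add: power2_diff)
    finally show ?thesis by simp
  qed
  have int: "integrable ?M \<psi>"
  proof (rule Bochner_Integration.integrable_bound)
    show "integrable ?M (\<lambda>x. 1 + (\<psi> x)\<^sup>2)"
      using integrable_const sqM by (rule Bochner_Integration.integrable_add)
    show "AE x in ?M. norm (\<psi> x) \<le> norm (1 + (\<psi> x)\<^sup>2)"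
      by (rule AE_I2) (use abs in simp)
  qed fact
  have M: "measure ?M (space ?M) = darea T \<nu>"
    using measure_dcell_part[OF \<nu>] Ds by (simp add: measure_restrict_space)
  have avg: "(LINT x|?M. \<psi> x) = darea T \<nu> * a"
    using darea_pos[OF \<nu>] by (simp add: a_def davg_def)
  have "0 \<le> (LINT x|?M. (\<psi> x - a)\<^sup>2)" by (intro integral_nonneg_AE) simp
  also have "\<dots> = (LINT x|?M. (\<psi> x)\<^sup>2 - 2 * a * \<psi> x + a\<^sup>2)"
    by (intro Bochner_Integration.integral_cong) (auto simp: power2_eq_square algebra_simps)
  also have "\<dots> = (LINT x|?M. (\<psi> x)\<^sup>2) - (LINT x|?M. 2 * a * \<psi> x) + (LINT x|?M. a\<^sup>2)"
  proof -
    have i: "integrable ?M (\<lambda>x. 2 * a * \<psi> x)" using int by (rule integrable_mult_right)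
    show ?thesis
      by (simp only: Bochner_Integration.integral_add[OF Bochner_Integration.integrable_diff[OF sqM i] integrable_const]
          Bochner_Integration.integral_diff[OF sqM i])
  qed
  also have "\<dots> = (LINT x|?M. (\<psi> x)\<^sup>2) - 2 * a * (darea T \<nu> * a) + darea T \<nu> * a\<^sup>2"
    unfolding integral_mult_right_zero avg lebesgue_integral_const M by simp
  finally show "darea T \<nu> * (davg \<Omega> T \<psi> \<nu>)\<^sup>2
      \<le> (LINT x|lebesgue_on \<Omega>. indicat_real (dcell T \<nu>) x * (\<psi> x)\<^sup>2)"
    unfolding int_sq[symmetric] by (simp add: a_def power2_eq_square)
qed

lemma davg_norm_bound:
  assumes \<psi>: "\<psi> \<in> L2 \<Omega>"
  shows "(\<Sum>\<nu>\<in>DI T. darea T \<nu> * (davg \<Omega> T \<psi> \<nu>)\<^sup>2) \<le> (L2norm \<Omega> \<psi>)\<^sup>2"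
proof -
  have "(\<Sum>\<nu>\<in>DI T. darea T \<nu> * (davg \<Omega> T \<psi> \<nu>)\<^sup>2)
      \<le> (\<Sum>\<nu>\<in>DI T. LINT x|lebesgue_on \<Omega>. indicat_real (dcell T \<nu>) x * (\<psi> x)\<^sup>2)"
    by (intro sum_mono davg_square_bound(1) \<psi>)
  also have "\<dots> = (LINT x|lebesgue_on \<Omega>. (\<Sum>\<nu>\<in>DI T. indicat_real (dcell T \<nu>) x * (\<psi> x)\<^sup>2))"
    by (intro Bochner_Integration.integral_sum[symmetric] davg_square_bound(2) \<psi>)
  also have "\<dots> = (LINT x|lebesgue_on \<Omega>. (\<psi> x)\<^sup>2)"
  proof (rule integral_cong_AE)
    show "(\<lambda>x. \<Sum>\<nu>\<in>DI T. indicat_real (dcell T \<nu>) x * (\<psi> x)\<^sup>2) \<in> borel_measurable (lebesgue_on \<Omega>)"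
      by (intro borel_measurable_sum borel_measurable_integrable davg_square_bound(2) \<psi>)
    show "(\<lambda>x. (\<psi> x)\<^sup>2) \<in> borel_measurable (lebesgue_on \<Omega>)"
      using \<psi> by (auto simp: L2_def)
    show "AE x in lebesgue_on \<Omega>. (\<Sum>\<nu>\<in>DI T. indicat_real (dcell T \<nu>) x * (\<psi> x)\<^sup>2) = (\<psi> x)\<^sup>2"
      using AE_unique_dcell
    proof eventually_elim
      case (elim x)
      then obtain \<nu> where \<nu>: "\<nu> \<in> DI T" "\<forall>\<mu>\<in>DI T. x \<in> dcell T \<mu> \<longleftrightarrow> \<mu> = \<nu>" by blast
      show ?case using sum_unique_dcell[OF \<nu>, of "\<lambda>_. (\<psi> x)\<^sup>2"] by (simp only: mult.commute)
    qed
  qed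
  also have "\<dots> = (L2norm \<Omega> \<psi>)\<^sup>2"
    unfolding L2norm_def by (simp add: integral_nonneg_AE)
  finally show ?thesis .
qed

lemma stokes_bound:
  assumes \<psi>: "\<psi> \<in> L2 \<Omega>" and u: "u \<in> V_h \<Omega> T"
    and s: "stokes_h \<Omega> T (\<lambda>e. perp_grad_h \<Omega> T (davg \<Omega> T \<psi>) e + grad_h T \<phi> e) u p"
  shows "norm_1h \<Omega> T u \<le> L2norm \<Omega> \<psi>"
proof -
  let ?a = "davg \<Omega> T \<psi>" and ?c = "curl_h T u"
  have "2 * (\<Sum>\<nu>\<in>DI T. darea T \<nu> * (?c \<nu>)\<^sup>2) = (\<Sum>\<nu>\<in>DI T. - 2 * (darea T \<nu> * ?a \<nu> * ?c \<nu>))"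
    unfolding stokes_energy[OF u s] by (simp add: sum_distrib_left sum_negf)
  \<comment> \<open>Young's inequality termwise; the doubled left side absorbs the curl term, which
    is how the constant becomes 1.\<close>
  also have "\<dots> \<le> (\<Sum>\<nu>\<in>DI T. darea T \<nu> * (?a \<nu>)\<^sup>2 + darea T \<nu> * (?c \<nu>)\<^sup>2)"
  proof (rule sum_mono)
    fix \<nu> assume "\<nu> \<in> DI T"
    then have "0 \<le> darea T \<nu> * (?a \<nu> + ?c \<nu>)\<^sup>2" using darea_pos[of \<nu>] by simp
    then show "- 2 * (darea T \<nu> * ?a \<nu> * ?c \<nu>) \<le> darea T \<nu> * (?a \<nu>)\<^sup>2 + darea T \<nu> * (?c \<nu>)\<^sup>2"
      by (simp add: power2_eq_square algebra_simps)
  qed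
  finally have "(norm_1h \<Omega> T u)\<^sup>2 \<le> (\<Sum>\<nu>\<in>DI T. darea T \<nu> * (?a \<nu>)\<^sup>2)"
    unfolding norm_1h_square by (simp add: sum.distrib)
  also have "\<dots> \<le> (L2norm \<Omega> \<psi>)\<^sup>2" by (rule davg_norm_bound[OF \<psi>])
  finally show ?thesis
    by (rule power2_le_imp_le) (simp add: L2norm_def integral_nonneg_AE)
qed

end

text \<open>The pressure clause is conditional on \<open>interior_connected\<close> because the
  scheme sees pressure differences across interior edges only: a corner cell bounded by boundary
  edges alone would carry a free value.\<close>

theorem theorem3p4:
  fixes \<Omega> :: "(real^2) set" and m M :: real and H :: "real set" and T :: "real \<Rightarrow> mesh"
  assumes "polygonal_domain \<Omega>"
    and "0 < m" and "0 < M"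
    and "H \<subseteq> {0<..}" and "0 islimpt H"
    and "\<And>h. h \<in> H \<Longrightarrow> staggered_mesh \<Omega> (T h)"
    and "\<And>h. h \<in> H \<Longrightarrow> quasi_uniform m M \<Omega> h (T h)"
    and "\<And>h. h \<in> H \<Longrightarrow> bisecting (T h)"
  shows "\<exists>C K :: real. \<forall>f \<in> L2 \<Omega>. \<forall>\<psi> \<phi>. helmholtz \<Omega> f \<psi> \<phi> \<longrightarrow> (\<forall>h \<in> H.
      (\<exists>!u. u \<in> V_h \<Omega> (T h) \<and> (\<exists>p. stokes_h \<Omega> (T h) (forcing_h \<Omega> (T h) \<psi> \<phi>) u p)) \<and>
      (\<forall>u \<in> V_h \<Omega> (T h). \<forall>p. stokes_h \<Omega> (T h) (forcing_h \<Omega> (T h) \<psi> \<phi>) u p \<longrightarrow>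
         (interior_connected (T h) \<longrightarrow>
            (\<forall>q. stokes_h \<Omega> (T h) (forcing_h \<Omega> (T h) \<psi> \<phi>) u q \<longleftrightarrow>
                 (\<exists>c. \<forall>i \<in> PI (T h). q i = p i + c))) \<and>
         norm_1h \<Omega> (T h) u \<le> C * L2norm \<Omega> \<psi> + K))"
\<comment> \<open>Both constants are fixed before \<open>f\<close> and \<open>h\<close> are
  introduced, hence independent of the mesh.\<close>
proof (rule exI[of _ 1], rule exI[of _ 0], intro ballI allI impI)
  fix f \<psi> \<phi> h
  assume "helmholtz \<Omega> f \<psi> \<phi>" and h: "h \<in> H"
  then have \<psi>: "\<psi> \<in> L2 \<Omega>" by (auto simp: helmholtz_def H10_grad_def H1_grad_def)
  have mh: "0 < m * h" using h assms(2,4) by auto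
  interpret staggered_domain \<Omega> "T h"
  proof
    show "0 < plen \<Omega> (T h) e" "0 < dlen (T h) e" if "e \<in> EI (T h)" for e
      using assms(7)[OF h] mh that unfolding quasi_uniform_def by force+
  qed (use assms(1,6) h in auto)
  define F where "F = forcing_h \<Omega> (T h) \<psi> \<phi>"
  have F: "F = (\<lambda>e. perp_grad_h \<Omega> (T h) (davg \<Omega> (T h) \<psi>) e + grad_h (T h) (pavg \<Omega> (T h) \<phi>) e)"
    by (simp add: F_def forcing_h_def[abs_def])
  have "\<exists>!u. u \<in> V_h \<Omega> (T h) \<and> (\<exists>p. stokes_h \<Omega> (T h) F u p)"
  proof (rule ex_ex1I)
    show "\<exists>u. u \<in> V_h \<Omega> (T h) \<and> (\<exists>p. stokes_h \<Omega> (T h) F u p)"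
      unfolding F using stokes_exists by blast
    show "u = v" if "u \<in> V_h \<Omega> (T h) \<and> (\<exists>p. stokes_h \<Omega> (T h) F u p)"
      "v \<in> V_h \<Omega> (T h) \<and> (\<exists>p. stokes_h \<Omega> (T h) F v p)" for u v
      using that by (elim conjE exE) (rule stokes_unique)
  qed
  moreover have bound: "norm_1h \<Omega> (T h) u \<le> 1 * L2norm \<Omega> \<psi> + 0"
    if "u \<in> V_h \<Omega> (T h)" "stokes_h \<Omega> (T h) F u p" for u p
    using stokes_bound[OF \<psi> that(1)] that(2) unfolding F by simp
  ultimately show "(\<exists>!u. u \<in> V_h \<Omega> (T h) \<and> (\<exists>p. stokes_h \<Omega> (T h) (forcing_h \<Omega> (T h) \<psi> \<phi>) u p)) \<and>
      (\<forall>u \<in> V_h \<Omega> (T h). \<forall>p. stokes_h \<Omega> (T h) (forcing_h \<Omega> (T h) \<psi> \<phi>) u p \<longrightarrow>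
         (interior_connected (T h) \<longrightarrow>
            (\<forall>q. stokes_h \<Omega> (T h) (forcing_h \<Omega> (T h) \<psi> \<phi>) u q \<longleftrightarrow>
                 (\<exists>c. \<forall>i \<in> PI (T h). q i = p i + c))) \<and>
         norm_1h \<Omega> (T h) u \<le> 1 * L2norm \<Omega> \<psi> + 0)"
    unfolding F_def[symmetric] by (intro conjI ballI allI impI) (assumption | rule stokes_pressure bound)+
qed

end
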